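(* Let $M$ be a $q$-matroid. If $M\cong M_1\square\cdots\square M_k\cong N_1\square\cdots\square N_r$, where all $M_i$ and $N_j$ are irreducible $q$-matroids on nonzero ground spaces, then $k=r$ and $M_i\cong N_i$ for all $i\in\{1,\dots,k\}$.
   Context: For a finite-dimensional $\mathbb{F}_q$-space $E$, $\mathcal{L}(E)$ is its subspace lattice. A $q$-matroid $M=(E,r)$ is given by $r:\mathcal{L}(E)\to\mathbb{Z}$ with (R1) $0\le r(A)\le\dim(A)$; (R2) $A\le B\Rightarrow r(A)\le r(B)$; (R3) $r(A+B)+r(A\cap B)\le r(A)+r(B)$. $A$ is independent if $r(A)=\dim A$. $(E_1,r_1)\cong(E_2,r_2)$ means there is an $\mathbb{F}_q$-linear isomorphism $\tau:E_1\to E_2$ with $r_2(\tau(V))=r_1(V)$ for all $V\le E_1$. Free product: for $q$-matroids $M_i=(E_i,r_i)$, $i=1,2$, with projections $\pi_i:E_1\oplus E_2\to E_i$ and embeddings $\iota_i:E_i\to E_1\oplus E_2$, put $\lambda_1(A)=r_1(E_1)-r_1(A)$ and $\nu_2(B)=\dim(B)-r_2(B)$. $M_1\square M_2$ is the $q$-matroid on $E_1\oplus E_2$ whose independent spaces are exactly the $I\le E_1\oplus E_2$ with $\pi_1(I\cap\iota_1(E_1))$ independent in $M_1$ and $\lambda_1(\pi_1(I\cap\iota_1(E_1)))\ge\nu_2(\pi_2(I))$. It is associative. A $q$-matroid is irreducible if it is not isomorphic to a free product of two $q$-matroids with nonzero ground spaces. *)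

theory Defs
  imports "HOL-Analysis.Product_Vector" "HOL-Library.Function_Algebras" "HOL-Library.FuncSet"
begin

text \<open>
  The finite field \<open>\<bbbF>\<^sub>q\<close> is a type \<open>'k :: {field, finite}\<close>. A finite-dimensional
  \<open>\<bbbF>\<^sub>q\<close>-space \<open>E\<close> is a subspace, spanned by a finite set, of a vector space that is the whole of a
  type \<open>'v\<close>; its scalar multiplication is part of the data. The rank function is relevant only on the
  subspaces of \<open>E\<close>; its other values are arbitrary and ignored by every notion below, so
  \<open>q\<close>-matroids are compared by isomorphism and never by equality of records.
\<close>

record ('k, 'v) qmat =
  scal :: "'k \<Rightarrow> 'v \<Rightarrow> 'v"
  ground :: "'v set"
  rank :: "'v set \<Rightarrow> int"

text \<open>The subspace lattice \<open>\<L>(E)\<close> of the ground space.\<close>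

definition subspaces :: "('k::{field,finite}, 'v::ab_group_add) qmat \<Rightarrow> 'v set set" where
  "subspaces M = {A. module.subspace (scal M) A \<and> A \<subseteq> ground M}"

abbreviation qdim :: "('k::{field,finite}, 'v::ab_group_add) qmat \<Rightarrow> 'v set \<Rightarrow> nat" where
  "qdim M \<equiv> vector_space.dim (scal M)"

definition qmatroid :: "('k::{field,finite}, 'v::ab_group_add) qmat \<Rightarrow> bool" where
  "qmatroid M \<longleftrightarrow>
     vector_space (scal M) \<and>
     (\<exists>B. finite B \<and> ground M = module.span (scal M) B) \<and>
     (\<forall>A\<in>subspaces M. 0 \<le> rank M A \<and> rank M A \<le> int (qdim M A)) \<and>
     (\<forall>A\<in>subspaces M. \<forall>B\<in>subspaces M. A \<subseteq> B \<longrightarrow> rank M A \<le> rank M B) \<and>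
     (\<forall>A\<in>subspaces M. \<forall>B\<in>subspaces M.
        rank M {a + b |a b. a \<in> A \<and> b \<in> B} + rank M (A \<inter> B) \<le> rank M A + rank M B)"

definition indep :: "('k::{field,finite}, 'v::ab_group_add) qmat \<Rightarrow> 'v set \<Rightarrow> bool" where
  "indep M A \<longleftrightarrow> A \<in> subspaces M \<and> rank M A = int (qdim M A)"

text \<open>Only the restriction of \<open>\<tau>\<close> to the ground space of \<open>M\<close> matters.\<close>

definition qmat_iso ::
  "('k::{field,finite}, 'v::ab_group_add) qmat \<Rightarrow> ('k, 'w::ab_group_add) qmat \<Rightarrow> bool"
  (infix \<open>\<cong>\<^sub>q\<close> 50) where
  "M \<cong>\<^sub>q N \<longleftrightarrow>
     (\<exists>\<tau>. bij_betw \<tau> (ground M) (ground N) \<and>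
          (\<forall>x\<in>ground M. \<forall>y\<in>ground M. \<tau> (x + y) = \<tau> x + \<tau> y) \<and>
          (\<forall>c. \<forall>x\<in>ground M. \<tau> (scal M c x) = scal N c (\<tau> x)) \<and>
          (\<forall>V\<in>subspaces M. rank N (\<tau> ` V) = rank M V))"

definition corank :: "('k::{field,finite}, 'v::ab_group_add) qmat \<Rightarrow> 'v set \<Rightarrow> int" where
  "corank M A = rank M (ground M) - rank M A"

definition nullity :: "('k::{field,finite}, 'v::ab_group_add) qmat \<Rightarrow> 'v set \<Rightarrow> int" where
  "nullity M B = int (qdim M B) - rank M B"

text \<open>
  The external direct sum \<open>E\<^sub>1 \<oplus> E\<^sub>2\<close> is \<open>E\<^sub>1 \<times> E\<^sub>2\<close>, with \<open>\<pi>\<^sub>1 = fst\<close>, \<open>\<pi>\<^sub>2 = snd\<close>, \<open>\<iota>\<^sub>1 x = (x, 0)\<close>.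
\<close>

definition free_indep ::
  "('k::{field,finite}, 'v::ab_group_add) qmat \<Rightarrow> ('k, 'w::ab_group_add) qmat \<Rightarrow> ('v \<times> 'w) set \<Rightarrow> bool"
  where
  "free_indep M\<^sub>1 M\<^sub>2 I \<longleftrightarrow>
     module.subspace (module_prod.scale (scal M\<^sub>1) (scal M\<^sub>2)) I \<and>
     I \<subseteq> ground M\<^sub>1 \<times> ground M\<^sub>2 \<and>
     indep M\<^sub>1 (fst ` (I \<inter> (\<lambda>x. (x, 0)) ` ground M\<^sub>1)) \<and>
     corank M\<^sub>1 (fst ` (I \<inter> (\<lambda>x. (x, 0)) ` ground M\<^sub>1)) \<ge> nullity M\<^sub>2 (snd ` I)"

text \<open>
  A \<open>q\<close>-matroid is determined by its independent spaces: the rank of a space is the maximal dimension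
  of an independent subspace (lemma \<open>rank_eq_Max_indep\<close> below). Hence the rank function here is the
  only possible one for a \<open>q\<close>-matroid whose independent spaces are the \<open>free_indep\<close> ones, and lemma
  \<open>indep_free_product\<close> shows that these are indeed its independent spaces.
\<close>

definition free_product ::
  "('k::{field,finite}, 'v::ab_group_add) qmat \<Rightarrow> ('k, 'w::ab_group_add) qmat \<Rightarrow> ('k, 'v \<times> 'w) qmat"
  (infixr \<open>\<box>\<close> 70) where
  "M\<^sub>1 \<box> M\<^sub>2 =
     \<lparr>scal = module_prod.scale (scal M\<^sub>1) (scal M\<^sub>2),
      ground = ground M\<^sub>1 \<times> ground M\<^sub>2,
      rank = (\<lambda>A. int (Max {vector_space.dim (module_prod.scale (scal M\<^sub>1) (scal M\<^sub>2)) I |I.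
                              free_indep M\<^sub>1 M\<^sub>2 I \<and> I \<subseteq> A}))\<rparr>"

text \<open>
  Quantification over the factors is restricted to the type \<open>'v\<close> of the ground space of \<open>M\<close>. This
  loses nothing: the ground space of a factor of \<open>M\<close> has dimension at most that of \<open>ground M\<close>, so
  the factor is isomorphic to a \<open>q\<close>-matroid on a subspace of \<open>ground M\<close>.
\<close>

definition irreducible_qmat :: "('k::{field,finite}, 'v::ab_group_add) qmat \<Rightarrow> bool" where
  "irreducible_qmat M \<longleftrightarrow>
     \<not> (\<exists>(M\<^sub>1 :: ('k, 'v) qmat) (M\<^sub>2 :: ('k, 'v) qmat).
          qmatroid M\<^sub>1 \<and> qmatroid M\<^sub>2 \<and> ground M\<^sub>1 \<noteq> {0} \<and> ground M\<^sub>2 \<noteq> {0} \<and> M \<cong>\<^sub>q M\<^sub>1 \<box> M\<^sub>2)"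

text \<open>
  The iterated product \<open>M\<^sub>1 \<box> (M\<^sub>2 \<box> (\<dots> \<box> M\<^sub>k))\<close> of a nonempty list. As the type of the ground space
  must not depend on \<open>k\<close>, the elements \<open>(x\<^sub>1, \<dots>, x\<^sub>k)\<close> of the direct sum are encoded as the sequences
  \<open>x\<^sub>1, \<dots>, x\<^sub>k, 0, 0, \<dots>\<close> of type \<open>nat \<Rightarrow> 'v\<close>: a one-element list gives a copy of its element, and
  each further product is transported along the bijection \<open>(x, f) \<mapsto> case_nat x f\<close> from
  \<open>'v \<times> (nat \<Rightarrow> 'v)\<close> to \<open>nat \<Rightarrow> 'v\<close>, with inverse \<open>f \<mapsto> (f 0, f \<circ> Suc)\<close>. The empty list is left
  unspecified.
\<close>

definition seq_single :: "('k::{field,finite}, 'v::ab_group_add) qmat \<Rightarrow> ('k, nat \<Rightarrow> 'v) qmat" where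
  "seq_single M =
     \<lparr>scal = (\<lambda>c f i. scal M c (f i)),
      ground = (\<lambda>x. case_nat x (\<lambda>_. 0)) ` ground M,
      rank = (\<lambda>A. rank M ((\<lambda>f. f 0) ` A))\<rparr>"

definition seq_cons ::
  "('k::{field,finite}, 'v::ab_group_add \<times> (nat \<Rightarrow> 'v)) qmat \<Rightarrow> ('k, nat \<Rightarrow> 'v) qmat" where
  "seq_cons P =
     (let \<phi> = (\<lambda>(x, f). case_nat x f); \<psi> = (\<lambda>f. (f 0, f \<circ> Suc))
      in \<lparr>scal = (\<lambda>c f. \<phi> (scal P c (\<psi> f))), ground = \<phi> ` ground P, rank = (\<lambda>A. rank P (\<psi> ` A))\<rparr>)"

fun free_product_list ::
  "('k::{field,finite}, 'v::ab_group_add) qmat list \<Rightarrow> ('k, nat \<Rightarrow> 'v) qmat" where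
  "free_product_list [M] = seq_single M"
| "free_product_list (M # N # Ms) = seq_cons (M \<box> free_product_list (N # Ms))"

lemma finite_ground:
  assumes "qmatroid M"
  shows "finite (ground M)"
proof -
  interpret vector_space "scal M" using assms by (simp add: qmatroid_def)
  obtain B where B: "finite B" "ground M = span B" using assms by (auto simp: qmatroid_def)
  have "span B \<subseteq> (\<lambda>u. \<Sum>v\<in>B. scal M (u v) v) ` (B \<rightarrow>\<^sub>E UNIV)"
  proof
    fix x assume "x \<in> span B"
    then obtain u where "x = (\<Sum>v\<in>B. scal M (u v) v)" using B(1) by (auto simp: span_finite)
    then have "x = (\<Sum>v\<in>B. scal M (restrict u B v) v)" by (simp cong: sum.cong)
    then show "x \<in> (\<lambda>u. \<Sum>v\<in>B. scal M (u v) v) ` (B \<rightarrow>\<^sub>E UNIV)"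
      by (rule image_eqI[where x = "restrict u B"]) simp
  qed
  moreover have "finite (B \<rightarrow>\<^sub>E (UNIV::'a set))" using B(1) by (intro finite_PiE) auto
  ultimately show ?thesis
    unfolding B(2) by (meson finite_surj)
qed

lemma subspace_ground:
  assumes "qmatroid M"
  shows "ground M \<in> subspaces M"
proof -
  interpret vector_space "scal M" using assms by (simp add: qmatroid_def)
  show ?thesis using assms by (auto simp: qmatroid_def subspaces_def)
qed

lemma rank_eq_Max_indep:
  assumes M: "qmatroid M" and V: "V \<in> subspaces M"
  shows "rank M V = int (Max {qdim M I |I. indep M I \<and> I \<subseteq> V})"
proof -
  interpret vector_space "scal M" using M by (simp add: qmatroid_def)
  have R1: "0 \<le> rank M A" "rank M A \<le> int (dim A)" if "A \<in> subspaces M" for A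
    using M that by (auto simp: qmatroid_def)
  have R2: "rank M A \<le> rank M B" if "A \<in> subspaces M" "B \<in> subspaces M" "A \<subseteq> B" for A B
    using M that by (auto simp: qmatroid_def)
  have R3: "rank M {a + b |a b. a \<in> A \<and> b \<in> B} + rank M (A \<inter> B) \<le> rank M A + rank M B"
    if "A \<in> subspaces M" "B \<in> subspaces M" for A B
    using M that by (auto simp: qmatroid_def)
  have sV: "subspace V" and VE: "V \<subseteq> ground M" using V by (auto simp: subspaces_def)
  have fV: "finite V" using finite_ground[OF M] VE finite_subset by blast
  have sub: "A \<in> subspaces M" if "subspace A" "A \<subseteq> V" for A
    using that VE by (auto simp: subspaces_def)
  let ?D = "{dim I |I. indep M I \<and> I \<subseteq> V}"
  have "{I. indep M I \<and> I \<subseteq> V} \<subseteq> Pow V" by auto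
  then have "finite {I. indep M I \<and> I \<subseteq> V}" using fV finite_subset by blast
  moreover have "?D = dim ` {I. indep M I \<and> I \<subseteq> V}" by auto
  ultimately have fD: "finite ?D" by simp
  have "dim {0} = 0" using dim_le_card[of "{0}" "{}"] by simp
  then have "indep M {0}"
    using R1[of "{0}"] sub[of "{0}"] subspace_0[OF sV] subspace_single_0 by (simp add: indep_def)
  then have "?D \<noteq> {}" using subspace_0[OF sV] by blast
  then have "Max ?D \<in> ?D" by (rule Max_in[OF fD])
  then obtain I where I: "indep M I" "I \<subseteq> V" "dim I = Max ?D"
    unfolding mem_Collect_eq by metis
  have Imax: "dim J \<le> dim I" if "indep M J" "J \<subseteq> V" for J
    using I(3) Max_ge[OF fD, of "dim J"] that by auto
  have sI: "subspace I" and rI: "rank M I = int (dim I)" using I(1) by (auto simp: indep_def subspaces_def)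
  have adj: "rank M (span (insert x I)) = rank M I" if x: "x \<in> V" for x
  proof -
    let ?J = "span (insert x I)"
    have JV: "?J \<subseteq> V" using x I(2) sV by (intro span_minimal) auto
    have Js: "?J \<in> subspaces M" using sub[OF subspace_span JV] .
    obtain b where b: "b \<subseteq> I" "independent b" "I \<subseteq> span b" "card b = dim I"
      using basis_exists by blast
    have fb: "finite b" by (rule finite_subset[OF subset_trans[OF b(1) I(2)] fV])
    have "insert x I \<subseteq> span (insert x b)"
      using b(3) span_mono[OF subset_insertI, of b x] span_base[of x "insert x b"] by blast
    then have "?J \<subseteq> span (insert x b)" by (intro span_minimal subspace_span)
    then have "dim ?J \<le> card (insert x b)" using fb by (intro dim_le_card) auto
    also have "\<dots> \<le> dim I + 1" using fb b(4) by (simp add: card_insert_if)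
    finally have dJ: "dim ?J \<le> dim I + 1" .
    have "rank M I \<le> rank M ?J"
      using R2[of I ?J] I(1) Js span_superset[of "insert x I"] by (auto simp: indep_def)
    moreover have "rank M ?J \<noteq> int (dim I) + 1"
    proof
      assume *: "rank M ?J = int (dim I) + 1"
      then have "dim ?J = dim I + 1" using dJ R1(2)[OF Js] by linarith
      then have "indep M ?J" using * Js by (simp add: indep_def)
      then show False using Imax[OF _ JV] \<open>dim ?J = dim I + 1\<close> by simp
    qed
    ultimately show ?thesis using R1(2)[OF Js] dJ rI by linarith
  qed
  let ?F = "{W. subspace W \<and> I \<subseteq> W \<and> W \<subseteq> V \<and> rank M W = rank M I}"
  have "?F \<subseteq> Pow V" by auto
  then have "finite ?F" using fV finite_subset by blast
  moreover have "I \<in> ?F" using sI I(2) by auto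
  ultimately obtain W where W: "W \<in> ?F" and Wmax: "\<And>U. U \<in> ?F \<Longrightarrow> W \<subseteq> U \<Longrightarrow> U = W"
    using finite_has_maximal[of ?F] by (metis (no_types, lifting) empty_iff)
  have "V \<subseteq> W"
  proof
    fix x assume x: "x \<in> V"
    let ?J = "span (insert x I)"
    let ?U = "{a + b |a b. a \<in> W \<and> b \<in> ?J}"
    have JV: "?J \<subseteq> V" using x I(2) sV by (intro span_minimal) auto
    have sW: "subspace W" "I \<subseteq> W" "W \<subseteq> V" "rank M W = rank M I" using W by auto
    have sU: "subspace ?U" by (rule subspace_sums[OF sW(1) subspace_span])
    have UV: "?U \<subseteq> V" using sW(3) JV subspace_add[OF sV] by blast
    have WU: "W \<subseteq> ?U"
    proof
      fix w assume "w \<in> W" then have "w = w + 0 \<and> w \<in> W \<and> 0 \<in> ?J" by (simp add: span_zero)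
      then show "w \<in> ?U" by blast
    qed
    have "x = 0 + x \<and> 0 \<in> W \<and> x \<in> ?J" using subspace_0[OF sW(1)] by (simp add: span_base)
    then have xU: "x \<in> ?U" by blast
    have "rank M I \<le> rank M (W \<inter> ?J)"
      using sW sI I(1) JV span_superset[of "insert x I"]
      by (intro R2 sub subspace_inter) (auto simp: indep_def)
    moreover have "rank M ?U + rank M (W \<inter> ?J) \<le> rank M W + rank M ?J"
      by (rule R3[OF sub[OF sW(1,3)] sub[OF subspace_span JV]])
    moreover have "rank M W \<le> rank M ?U" using R2[OF sub[OF sW(1,3)] sub[OF sU UV] WU] .
    ultimately have "rank M ?U = rank M I" using adj[OF x] sW(4) by linarith
    then have "?U \<in> ?F" using sU UV WU sW(2) by blast
    then have "?U = W" using Wmax WU by blast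
    then show "x \<in> W" using xU by simp
  qed
  then have "W = V" using W by blast
  then have "rank M V = rank M I" using W by blast
  then show ?thesis by (simp only: rI I(3))
qed

lemma indep_free_product:
  fixes M\<^sub>1 :: "('a::{field,finite}, 'b::ab_group_add) qmat"
    and M\<^sub>2 :: "('a, 'c::ab_group_add) qmat"
  assumes M1: "qmatroid M\<^sub>1" and M2: "qmatroid M\<^sub>2"
  shows "indep (M\<^sub>1 \<box> M\<^sub>2) I \<longleftrightarrow> free_indep M\<^sub>1 M\<^sub>2 I"
proof -
  interpret v1: vector_space "scal M\<^sub>1" using M1 by (simp add: qmatroid_def)
  interpret v2: vector_space "scal M\<^sub>2" using M2 by (simp add: qmatroid_def)
  interpret vector_space_prod "scal M\<^sub>1" "scal M\<^sub>2" ..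
  let ?F = "free_indep M\<^sub>1 M\<^sub>2"
  let ?D = "\<lambda>A. {p.dim J |J. ?F J \<and> J \<subseteq> A}"
  let ?E = "ground M\<^sub>1 \<times> ground M\<^sub>2"
  have fE: "finite ?E" using finite_ground[OF M1] finite_ground[OF M2] by simp
  have rank: "rank (M\<^sub>1 \<box> M\<^sub>2) A = int (Max (?D A))" for A by (simp add: free_product_def)
  have dim: "qdim (M\<^sub>1 \<box> M\<^sub>2) A = p.dim A" for A by (simp add: free_product_def)
  have subs: "A \<in> subspaces (M\<^sub>1 \<box> M\<^sub>2) \<longleftrightarrow> p.subspace A \<and> A \<subseteq> ?E" for A
    by (simp add: free_product_def subspaces_def)
  have dim0: "v1.dim {0} = 0" "v2.dim {0} = 0"
    using v1.dim_le_card[of "{0}" "{}"] v2.dim_le_card[of "{0}" "{}"] by simp_all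
  have E0: "0 \<in> ground M\<^sub>1" "0 \<in> ground M\<^sub>2"
    using subspace_ground[OF M1] subspace_ground[OF M2] v1.subspace_0 v2.subspace_0
    by (auto simp: subspaces_def)
  have S0: "{0} \<in> subspaces M\<^sub>1" "{0} \<in> subspaces M\<^sub>2"
    using E0 by (auto simp: subspaces_def)
  have r0: "rank M\<^sub>1 {0} = 0" "rank M\<^sub>2 {0} = 0"
    using M1 M2 S0 dim0 by (force simp: qmatroid_def)+
  have "{0::'b \<times> 'c} \<inter> (\<lambda>x. (x, 0)) ` ground M\<^sub>1 = {0}" using E0 by (auto simp: zero_prod_def)
  then have fst0: "fst ` ({0::'b \<times> 'c} \<inter> (\<lambda>x. (x, 0)) ` ground M\<^sub>1) = {0}" by (simp only: image_insert image_empty fst_zero)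
  have snd0: "snd ` {0::'b \<times> 'c} = {0}" by simp
  have "rank M\<^sub>1 {0} \<le> rank M\<^sub>1 (ground M\<^sub>1)"
    using M1 S0(1) subspace_ground[OF M1] E0 by (auto simp: qmatroid_def)
  then have F0: "?F {0}"
    unfolding free_indep_def fst0 snd0
    using E0 S0 r0 dim0 p.subspace_single_0
    by (simp add: indep_def corank_def nullity_def zero_prod_def)
  have fD: "finite (?D A)" for A
  proof -
    have "{J. ?F J \<and> J \<subseteq> A} \<subseteq> Pow ?E" by (auto simp: free_indep_def)
    then have "finite {J. ?F J \<and> J \<subseteq> A}" using fE finite_subset by blast
    moreover have "?D A = p.dim ` {J. ?F J \<and> J \<subseteq> A}" by auto
    ultimately show ?thesis by simp
  qed
  have mono: "p.dim J \<le> p.dim A \<and> (p.dim J = p.dim A \<longrightarrow> J = A)"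
    if JA: "p.subspace J" "p.subspace A" "J \<subseteq> A" "A \<subseteq> ?E" for J A
  proof -
    have fA: "finite A" using JA(4) fE finite_subset by blast
    obtain b where b: "b \<subseteq> J" "p.independent b" "J \<subseteq> p.span b" "card b = p.dim J"
      using p.basis_exists by blast
    obtain b' where b': "b \<subseteq> b'" "b' \<subseteq> A" "p.independent b'" "A \<subseteq> p.span b'"
      using p.maximal_independent_subset_extend[of b A] b JA(3) by blast
    have fb': "finite b'" using b'(2) fA finite_subset by blast
    have c: "card b' = p.dim A" using p.basis_card_eq_dim b' by blast
    have "p.dim J \<le> p.dim A" using card_mono[OF fb' b'(1)] b(4) c by simp
    moreover have "J = A" if "p.dim J = p.dim A"
    proof -
      have "b = b'" using card_subset_eq[OF fb' b'(1)] that b(4) c by simp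
      then show ?thesis using b(1) b'(4) p.span_minimal[OF _ JA(1), of b] JA(3) by blast
    qed
    ultimately show ?thesis by blast
  qed
  show ?thesis
  proof
    assume "indep (M\<^sub>1 \<box> M\<^sub>2) I"
    then have I: "p.subspace I" "I \<subseteq> ?E" "Max (?D I) = p.dim I"
      by (auto simp: indep_def subs rank dim)
    have "?D I \<noteq> {}" using F0 p.subspace_0[OF I(1)] by blast
    then have "Max (?D I) \<in> ?D I" by (rule Max_in[OF fD])
    then obtain J where J: "?F J" "J \<subseteq> I" "p.dim J = p.dim I"
      unfolding I(3) mem_Collect_eq by metis
    then have "J = I" using mono[of J I] I by (auto simp: free_indep_def)
    then show "?F I" using J by simp
  next
    assume F: "?F I"
    then have I: "p.subspace I" "I \<subseteq> ?E" by (auto simp: free_indep_def)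
    have "Max (?D I) = p.dim I"
    proof (rule Max_eqI[OF fD])
      show "p.dim I \<in> ?D I" using F by blast
    next
      fix y assume "y \<in> ?D I"
      then obtain J where J: "y = p.dim J" "?F J" "J \<subseteq> I" by blast
      then show "y \<le> p.dim I" using mono[of J I] I by (auto simp: free_indep_def)
    qed
    then show "indep (M\<^sub>1 \<box> M\<^sub>2) I" using I by (simp add: indep_def subs rank dim)
  qed
qed

end

(*
  Call a space A a separator of M if every V satisfies r(V + A) = r(V) or nu(V Int A) = nu(V), where nu
  is the nullity. By the rank formula of the free product this says exactly that M is the free product
  of M|A and M/A, so factorizations of M into irreducible factors are the maximal chains of separators,
  the factors being the successive minors. If B and C are distinct separators covering a separator A,
  then A = B Int C and the minor (M|(B + C))/A is uniform; in a uniform q-matroid every space is a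
  separator, so this minor has dimension 2 and its two factors are the same, in the same order, for
  the chain through B and for the chain through C. The Jordan-Hoelder argument then compares any two
  maximal chains without ever permuting factors.
*)

theory Submission
  imports Defs "HOL-Library.Cardinality"
begin

subsection \<open>Subspaces over a finite field\<close>

text \<open>The usual Jordan-Hoelder exchange pairs the step from A to B with the step from C to D =
  B + C, and so produces a permutation. Here A to B is paired with A to C, and B to D with C to D.
  This works because a one-dimensional q-matroid is determined by its rank, 0 or 1, and because in a
  uniform interval of dimension 2 the rank grows as early as possible on every chain: the successive
  increases are 0, 0 or 1, 0 or 1, 1, whichever space is in the middle.

  Factors matter only up to isomorphism and live on unrelated types. The exchange therefore never
  compares isomorphism classes: one fixed list labels a flag through linear maps with prescribed
  kernel and image, and the same list is shown to label every other flag. Isomorphisms between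
  factors appear only at the end, when two lists label the same flag.\<close>

lemma card_kernel_image:
  fixes f :: "'a::ab_group_add \<Rightarrow> 'b::ab_group_add"
  assumes fin: "finite G" and zero: "0 \<in> G" and diff: "\<And>x y. x \<in> G \<Longrightarrow> y \<in> G \<Longrightarrow> x - y \<in> G"
    and add: "\<And>x y. x \<in> G \<Longrightarrow> y \<in> G \<Longrightarrow> f (x + y) = f x + f y"
  shows "card G = card {x \<in> G. f x = 0} * card (f ` G)"
proof -
  have plus: "x + y \<in> G" if "x \<in> G" "y \<in> G" for x y
    using diff[OF that(1) diff[OF zero that(2)]] by simp
  \<comment> \<open>Translation by a preimage \<open>g\<close> of \<open>b\<close> matches the fibre
    over \<open>b\<close> with the kernel. Only the additive structure enters, so the count also
    serves addition on \<open>A \<times> B\<close> in \<open>dim_ssum_Int\<close>.\<close>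
  have fiber: "card {x \<in> G. f x = b} = card {x \<in> G. f x = 0}" if "b \<in> f ` G" for b
  proof -
    obtain g where g: "g \<in> G" "f g = b" using \<open>b \<in> f ` G\<close> by blast
    have eq: "f (x - g) = f x - f g" if "x \<in> G" for x
      using add[OF diff[OF that g(1)] g(1)] by (simp add: algebra_simps)
    have "bij_betw (\<lambda>x. x - g) {x \<in> G. f x = b} {x \<in> G. f x = 0}"
    proof (rule bij_betw_byWitness[where f' = "\<lambda>x. x + g"])
      show "(\<lambda>x. x - g) ` {x \<in> G. f x = b} \<subseteq> {x \<in> G. f x = 0}"
        by (auto simp: eq g diff)
      show "(\<lambda>x. x + g) ` {x \<in> G. f x = 0} \<subseteq> {x \<in> G. f x = b}"
        by (auto simp: add g plus)
    qed auto
    then show ?thesis by (rule bij_betw_same_card)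
  qed
  have "card G = (\<Sum>b\<in>f ` G. card {x \<in> G. f x = b})"
    using sum.image_gen[OF fin, of "\<lambda>_. 1::nat" f] by simp
  also have "\<dots> = (\<Sum>b\<in>f ` G. card {x \<in> G. f x = 0})"
    by (rule sum.cong[OF refl fiber])
  finally show ?thesis by simp
qed

text \<open>Relative to a set, because the maps of \<open>qmat_iso\<close> and
  \<open>minor_map\<close> are constrained only on a subspace and arbitrary outside it.\<close>

definition lin_on ::
  "('k \<Rightarrow> 'v \<Rightarrow> 'v) \<Rightarrow> ('k \<Rightarrow> 'w \<Rightarrow> 'w) \<Rightarrow> 'v set \<Rightarrow> ('v::ab_group_add \<Rightarrow> 'w::ab_group_add) \<Rightarrow> bool"
  where "lin_on s t B \<tau> \<longleftrightarrow>
    (\<forall>x\<in>B. \<forall>y\<in>B. \<tau> (x + y) = \<tau> x + \<tau> y) \<and> (\<forall>c. \<forall>x\<in>B. \<tau> (s c x) = t c (\<tau> x))"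

text \<open>Coordinates in a basis. As there are at least two scalars, the cardinality determines
  the dimension, and dimension formulas reduce to counting.\<close>

lemma card_subspace:
  fixes s :: "'k::{field,finite} \<Rightarrow> 'v::ab_group_add \<Rightarrow> 'v"
  assumes "vector_space s" and V: "module.subspace s V" "finite V"
  shows "card V = CARD('k) ^ vector_space.dim s V"
proof -
  interpret vector_space s by fact
  obtain b where b: "b \<subseteq> V" "independent b" "V \<subseteq> span b" "card b = dim V"
    using basis_exists by blast
  have fb: "finite b" using b(1) V(2) finite_subset by blast
  have Vb: "V = span b" using b(1,3) span_minimal[OF _ V(1)] by blast
  let ?f = "\<lambda>u. \<Sum>v\<in>b. s (u v) v"
  have "bij_betw ?f (b \<rightarrow>\<^sub>E UNIV) V"
    unfolding bij_betw_def
  proof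
    show "inj_on ?f (b \<rightarrow>\<^sub>E UNIV)"
    proof (rule inj_onI)
      fix u w assume u: "u \<in> b \<rightarrow>\<^sub>E UNIV" and w: "w \<in> b \<rightarrow>\<^sub>E UNIV" and eq: "?f u = ?f w"
      have "(\<Sum>v\<in>b. s (u v - w v) v) = 0"
        using eq by (simp add: scale_left_diff_distrib sum_subtractf)
      then have "\<forall>v\<in>b. u v - w v = 0"
        using independentD[OF b(2) fb subset_refl, of "\<lambda>v. u v - w v"] by blast
      then show "u = w" by (intro PiE_ext[OF u w]) auto
    qed
    have "?f ` (b \<rightarrow>\<^sub>E UNIV) = range ?f"
    proof
      show "range ?f \<subseteq> ?f ` (b \<rightarrow>\<^sub>E UNIV)"
      proof
        fix x assume "x \<in> range ?f"
        then obtain u where "x = ?f u" by blast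
        then have "x = ?f (restrict u b)" by (simp cong: sum.cong)
        then show "x \<in> ?f ` (b \<rightarrow>\<^sub>E UNIV)" by (rule image_eqI[where x = "restrict u b"]) simp
      qed
    qed auto
    then show "?f ` (b \<rightarrow>\<^sub>E UNIV) = V" unfolding Vb span_finite[OF fb] .
  qed
  then have "card (b \<rightarrow>\<^sub>E (UNIV :: 'k set)) = card V" by (rule bij_betw_same_card)
  then show ?thesis using fb b(4) by (simp add: card_PiE)
qed

lemma two_le_card_field: "2 \<le> CARD('k::{field,finite})"
proof -
  have "card {0, 1::'k} \<le> CARD('k)" by (rule card_mono) auto
  then show ?thesis by simp
qed

lemma lin_on_mono: "lin_on s t B \<tau> \<Longrightarrow> A \<subseteq> B \<Longrightarrow> lin_on s t A \<tau>"
  unfolding lin_on_def by blast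

lemma lin_on_zero: "lin_on s t B \<tau> \<Longrightarrow> 0 \<in> B \<Longrightarrow> \<tau> 0 = 0"
  unfolding lin_on_def by (metis add_cancel_right_right)

lemma subspace_image:
  assumes "vector_space s" "vector_space t" and V: "module.subspace s V" and lin: "lin_on s t V \<tau>"
  shows "module.subspace t (\<tau> ` V)"
proof -
  interpret s: vector_space s by fact
  interpret t: vector_space t by fact
  have add: "\<tau> a + \<tau> b = \<tau> (a + b)" and scale: "t c (\<tau> a) = \<tau> (s c a)"
    if "a \<in> V" "b \<in> V" for a b c
    using lin that by (simp_all add: lin_on_def)
  have "0 \<in> \<tau> ` V"
    using s.subspace_0[OF V] lin_on_zero[OF lin s.subspace_0[OF V]] by (metis image_eqI)
  then show ?thesis
    by (auto intro!: t.subspaceI imageI simp: add scale s.subspace_add[OF V] s.subspace_scale[OF V])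
qed

lemma subspace_preimage:
  assumes "vector_space s" "vector_space t" and B: "module.subspace s B" and lin: "lin_on s t B \<tau>"
    and W: "module.subspace t W"
  shows "module.subspace s {x \<in> B. \<tau> x \<in> W}"
proof -
  interpret s: vector_space s by fact
  interpret t: vector_space t by fact
  have "\<tau> (a + b) = \<tau> a + \<tau> b" and "\<tau> (s c a) = t c (\<tau> a)"
    if "a \<in> B" "b \<in> B" for a b c
    using lin that by (simp_all add: lin_on_def)
  then show ?thesis
    using lin_on_zero[OF lin s.subspace_0[OF B]]
    by (auto intro!: s.subspaceI simp: s.subspace_0[OF B] t.subspace_0[OF W] s.subspace_add[OF B]
        t.subspace_add[OF W] s.subspace_scale[OF B] t.subspace_scale[OF W])
qed

text \<open>Rank-nullity for a map that is linear on \<open>V\<close> only, by comparing exponents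
  of the field size in \<open>card_kernel_image\<close>.\<close>

lemma dim_kernel_image:
  fixes s :: "'k::{field,finite} \<Rightarrow> 'v::ab_group_add \<Rightarrow> 'v" and t :: "'k \<Rightarrow> 'w::ab_group_add \<Rightarrow> 'w"
  assumes s: "vector_space s" and t: "vector_space t"
    and V: "module.subspace s V" "finite V" and lin: "lin_on s t V \<tau>"
  shows "vector_space.dim s V = vector_space.dim s {x \<in> V. \<tau> x = 0} + vector_space.dim t (\<tau> ` V)"
proof -
  interpret s: vector_space s by fact
  interpret t: vector_space t by fact
  have "module.subspace s {x \<in> V. \<tau> x \<in> {0}}"
    by (rule subspace_preimage[OF s t V(1) lin t.subspace_single_0])
  then have K: "s.subspace {x \<in> V. \<tau> x = 0}" by simp
  have "card V = card {x \<in> V. \<tau> x = 0} * card (\<tau> ` V)"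
    using V lin s.subspace_0[OF V(1)] s.subspace_diff[OF V(1)]
    by (intro card_kernel_image) (simp_all add: lin_on_def)
  then have "CARD('k) ^ s.dim V = CARD('k) ^ (s.dim {x \<in> V. \<tau> x = 0} + t.dim (\<tau> ` V))"
    using card_subspace[OF s V] card_subspace[OF s K]
      card_subspace[OF t subspace_image[OF s t V(1) lin]] V(2) by (simp add: power_add)
  then show ?thesis
    using two_le_card_field[where 'k='k] power_inject_exp[of "CARD('k)"] by simp
qed

text \<open>The sum that occurs in (R3); despite the symbol it is not meant to be direct.\<close>

definition ssum :: "'v::plus set \<Rightarrow> 'v set \<Rightarrow> 'v set" (infixl "\<oplus>" 65) where
  "A \<oplus> B = {a + b |a b. a \<in> A \<and> b \<in> B}"

section \<open>Subspace lattice, dimension and rank of one q-matroid\<close>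

locale qmat =
  fixes M :: "('k::{field,finite}, 'v::ab_group_add) qmat"
  assumes qmatroid: "qmatroid M"
begin

sublocale vector_space "scal M"
  using qmatroid by (simp add: qmatroid_def)

abbreviation "Sub \<equiv> subspaces M"
abbreviation "E \<equiv> ground M"
abbreviation "r \<equiv> rank M"
abbreviation "nul \<equiv> nullity M"

lemma Sub_iff: "A \<in> Sub \<longleftrightarrow> subspace A \<and> A \<subseteq> E"
  by (simp add: subspaces_def)

lemma finite_E [simp]: "finite E"
  by (rule finite_ground[OF qmatroid])

lemma finite_Sub: "A \<in> Sub \<Longrightarrow> finite A"
  using finite_subset[OF _ finite_E] by (simp add: Sub_iff)

lemma E_Sub [simp]: "E \<in> Sub"
  by (rule subspace_ground[OF qmatroid])

lemma zero_Sub [simp]: "{0} \<in> Sub"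
  using E_Sub subspace_0[of E] by (simp add: Sub_iff)

lemma zero_mem: "A \<in> Sub \<Longrightarrow> 0 \<in> A"
  using subspace_0 by (simp add: Sub_iff)

lemma Int_Sub [intro]: "A \<in> Sub \<Longrightarrow> B \<in> Sub \<Longrightarrow> A \<inter> B \<in> Sub"
  using subspace_inter by (auto simp: Sub_iff)

lemma ssum_Sub [intro]: "A \<in> Sub \<Longrightarrow> B \<in> Sub \<Longrightarrow> A \<oplus> B \<in> Sub"
  using subspace_sums[of A B] subspace_add[of E] E_Sub unfolding Sub_iff ssum_def by blast

lemma ssum_upper1: "A \<in> Sub \<Longrightarrow> B \<in> Sub \<Longrightarrow> A \<subseteq> A \<oplus> B"
  unfolding ssum_def using zero_mem[of B] by force

lemma ssum_upper2: "A \<in> Sub \<Longrightarrow> B \<in> Sub \<Longrightarrow> B \<subseteq> A \<oplus> B"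
  unfolding ssum_def using zero_mem[of A] by force

lemma ssum_least: "C \<in> Sub \<Longrightarrow> A \<subseteq> C \<Longrightarrow> B \<subseteq> C \<Longrightarrow> A \<oplus> B \<subseteq> C"
  unfolding ssum_def using subspace_add[of C] by (auto simp: Sub_iff)

lemma ssum_absorb: "A \<in> Sub \<Longrightarrow> B \<in> Sub \<Longrightarrow> B \<subseteq> A \<Longrightarrow> A \<oplus> B = A"
  by (simp add: ssum_least ssum_upper1 subset_antisym)

lemma ssum_mono: "A \<subseteq> A' \<Longrightarrow> B \<subseteq> B' \<Longrightarrow> A \<oplus> B \<subseteq> A' \<oplus> B'"
  unfolding ssum_def by blast

lemma ssum_commute: "A \<oplus> B = B \<oplus> (A :: 'v set)"
  unfolding ssum_def by (rule Collect_cong) (metis add.commute)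

lemma ssum_assoc: "A \<oplus> B \<oplus> C = A \<oplus> (B \<oplus> C :: 'v set)"
proof (rule set_eqI)
  fix x
  have "x \<in> A \<oplus> B \<oplus> C \<longleftrightarrow> (\<exists>a\<in>A. \<exists>b\<in>B. \<exists>c\<in>C. x = a + b + c)"
    unfolding ssum_def by blast
  moreover have "x \<in> A \<oplus> (B \<oplus> C) \<longleftrightarrow> (\<exists>a\<in>A. \<exists>b\<in>B. \<exists>c\<in>C. x = a + (b + c))"
    unfolding ssum_def by blast
  ultimately show "x \<in> A \<oplus> B \<oplus> C \<longleftrightarrow> x \<in> A \<oplus> (B \<oplus> C)"
    by (simp add: add.assoc)
qed

lemma modular_law:
  assumes "A \<in> Sub" "B \<in> Sub" "C \<in> Sub" "A \<subseteq> C"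
  shows "(A \<oplus> B) \<inter> C = A \<oplus> (B \<inter> C)"
proof
  show "(A \<oplus> B) \<inter> C \<subseteq> A \<oplus> (B \<inter> C)"
  proof
    fix x assume "x \<in> (A \<oplus> B) \<inter> C"
    then obtain a b where x: "x = a + b" "a \<in> A" "b \<in> B" "x \<in> C" by (auto simp: ssum_def)
    have "x - a \<in> C" using x(2,4) assms(3,4) subspace_diff by (auto simp: Sub_iff)
    then have "b \<in> C" using x(1) by simp
    then show "x \<in> A \<oplus> (B \<inter> C)" using x(1-3) unfolding ssum_def by blast
  qed
  show "A \<oplus> (B \<inter> C) \<subseteq> (A \<oplus> B) \<inter> C"
    by (intro Int_greatest ssum_mono ssum_least) (use assms in auto)
qed

lemma rank_bounds: "A \<in> Sub \<Longrightarrow> 0 \<le> r A" "A \<in> Sub \<Longrightarrow> r A \<le> int (dim A)"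
  using qmatroid by (auto simp: qmatroid_def)

lemma rank_mono: "A \<in> Sub \<Longrightarrow> B \<in> Sub \<Longrightarrow> A \<subseteq> B \<Longrightarrow> r A \<le> r B"
  using qmatroid by (auto simp: qmatroid_def)

lemma rank_submod: "A \<in> Sub \<Longrightarrow> B \<in> Sub \<Longrightarrow> r (A \<oplus> B) + r (A \<inter> B) \<le> r A + r B"
  using qmatroid by (auto simp: qmatroid_def ssum_def)

lemma card_Sub: "A \<in> Sub \<Longrightarrow> card A = CARD('k) ^ dim A"
  using card_subspace[OF vector_space_axioms, of A] finite_Sub by (simp add: Sub_iff)

lemma dim_mono: "A \<in> Sub \<Longrightarrow> B \<in> Sub \<Longrightarrow> A \<subseteq> B \<Longrightarrow> dim A \<le> dim B"
  using card_mono[of B A] finite_Sub[of B] two_le_card_field[where 'k='k]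
  by (simp add: card_Sub power_le_imp_le_exp)

lemma dim_eq_imp_eq: "A \<in> Sub \<Longrightarrow> B \<in> Sub \<Longrightarrow> A \<subseteq> B \<Longrightarrow> dim A = dim B \<Longrightarrow> A = B"
  using card_subset_eq[of B A] finite_Sub[of B] by (simp add: card_Sub)

lemma dim_zero [simp]: "dim {0} = 0"
  using dim_le_card[of "{0}" "{}"] by simp

lemma rank_zero [simp]: "r {0} = 0"
  using rank_bounds[OF zero_Sub] by simp

text \<open>Addition maps \<open>A \<times> B\<close> onto the sum, and its kernel is the
  antidiagonal copy of the intersection; then count.\<close>

lemma dim_ssum_Int:
  assumes A: "A \<in> Sub" and B: "B \<in> Sub"
  shows "dim (A \<oplus> B) + dim (A \<inter> B) = dim A + dim B"
proof -
  let ?f = "\<lambda>(a, b). a + b"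
  have "{x \<in> A \<times> B. ?f x = 0} = (\<lambda>x. (x, - x)) ` (A \<inter> B)"
  proof (intro set_eqI iffI)
    fix p assume "p \<in> {x \<in> A \<times> B. ?f x = 0}"
    then obtain a b where p: "p = (a, b)" "a \<in> A" "b \<in> B" "b = - a"
      by (auto simp: add_eq_0_iff)
    then have "a \<in> B" using B subspace_neg[of B b] by (simp add: Sub_iff)
    then show "p \<in> (\<lambda>x. (x, - x)) ` (A \<inter> B)" using p by blast
  next
    fix p assume "p \<in> (\<lambda>x. (x, - x)) ` (A \<inter> B)"
    then show "p \<in> {x \<in> A \<times> B. ?f x = 0}" using B subspace_neg[of B] by (auto simp: Sub_iff)
  qed
  then have k: "card {x \<in> A \<times> B. ?f x = 0} = card (A \<inter> B)"
    by (simp add: card_image inj_on_def)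
  have im: "?f ` (A \<times> B) = A \<oplus> B" by (force simp: ssum_def)
  have "x - y \<in> A \<times> B" if "x \<in> A \<times> B" "y \<in> A \<times> B" for x y
    using A B that subspace_diff by (cases x; cases y) (simp add: Sub_iff)
  moreover have "0 \<in> A \<times> B"
    using zero_mem[OF A] zero_mem[OF B] by (simp add: zero_prod_def)
  ultimately have "card (A \<times> B) = card {x \<in> A \<times> B. ?f x = 0} * card (?f ` (A \<times> B))"
    using finite_Sub[OF A] finite_Sub[OF B]
    by (intro card_kernel_image) (auto simp: algebra_simps)
  then have "CARD('k) ^ (dim A + dim B) = CARD('k) ^ (dim (A \<inter> B) + dim (A \<oplus> B))"
    unfolding k im using A B by (simp add: card_cartesian_product card_Sub Int_Sub ssum_Sub power_add)
  then show ?thesis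
    using two_le_card_field[where 'k='k] power_inject_exp[of "CARD('k)"] by simp
qed

lemma nul_supermod: "A \<in> Sub \<Longrightarrow> B \<in> Sub \<Longrightarrow> nul A + nul B \<le> nul (A \<oplus> B) + nul (A \<inter> B)"
  using rank_submod[of A B] dim_ssum_Int[of A B] by (simp add: nullity_def)

lemma exists_complement:
  assumes A: "A \<in> Sub" and B: "B \<in> Sub" and AB: "A \<subseteq> B"
  obtains C where "C \<in> Sub" "C \<subseteq> B" "A \<oplus> C = B" "A \<inter> C = {0}"
proof -
  obtain b where b: "b \<subseteq> A" "independent b" "A \<subseteq> span b" "card b = dim A"
    using basis_exists by blast
  obtain c where c: "b \<subseteq> c" "c \<subseteq> B" "independent c" "B \<subseteq> span c"
    using maximal_independent_subset_extend[of b B] b AB by blast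
  have fc: "finite c" using c(2) B finite_Sub finite_subset by blast
  let ?C = "span (c - b)"
  have CB: "?C \<subseteq> B" using c(2) B span_minimal[of "c - b" B] by (auto simp: Sub_iff)
  have C: "?C \<in> Sub" using CB B by (auto simp: Sub_iff)
  have "c \<subseteq> A \<oplus> ?C"
    using b(1) span_superset[of "c - b"] ssum_upper1[OF A C] ssum_upper2[OF A C] c by blast
  then have "B \<subseteq> A \<oplus> ?C"
    using c(4) span_minimal[of c "A \<oplus> ?C"] ssum_Sub[OF A C] by (auto simp: Sub_iff)
  moreover have "A \<oplus> ?C \<subseteq> B" by (rule ssum_least[OF B AB CB])
  ultimately have BC: "A \<oplus> ?C = B" by blast
  have "dim ?C \<le> card (c - b)" using fc dim_le_card[of ?C "c - b"] by simp
  moreover have "card c = dim B" using basis_card_eq_dim c by blast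
  ultimately have "dim {0} = dim (A \<inter> ?C)"
    using b(4) card_Diff_subset[OF finite_subset[OF c(1) fc] c(1)] card_mono[OF fc c(1)]
      dim_ssum_Int[OF A C] BC by simp
  then have "A \<inter> ?C = {0}"
    using dim_eq_imp_eq[OF zero_Sub Int_Sub[OF A C]] zero_mem[OF A] zero_mem[OF C] by blast
  then show thesis using that[OF C CB BC] by blast
qed

text \<open>A complement of \<open>A\<close> in \<open>B\<close> has rank at most its dimension, and
  submodularity bounds the growth by it. Equivalently, nullity is monotone
  (\<open>nul_mono\<close>).\<close>

lemma rank_increase:
  assumes A: "A \<in> Sub" and B: "B \<in> Sub" and AB: "A \<subseteq> B"
  shows "r B - r A \<le> int (dim B) - int (dim A)"
proof -
  obtain C where C: "C \<in> Sub" "A \<oplus> C = B" "A \<inter> C = {0}"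
    using exists_complement[OF A B AB] by blast
  then show ?thesis
    using rank_submod[OF A C(1)] dim_ssum_Int[OF A C(1)] rank_bounds(2)[OF C(1)] rank_bounds(1)[OF zero_Sub]
    by simp
qed

lemma nul_mono: "A \<in> Sub \<Longrightarrow> B \<in> Sub \<Longrightarrow> A \<subseteq> B \<Longrightarrow> nul A \<le> nul B"
  using rank_increase[of A B] by (simp add: nullity_def)

end

subsection \<open>Separators\<close>

text \<open>In any q-matroid r(V) is at most r(V + A) and at most r(V Int A) + dim V - dim (V Int
  A). The condition says that one of these bounds is attained, so that r(V) is their minimum; this
  is the shape of the rank formula \<open>rank_P\<close>.\<close>

definition free_separator :: "('k::{field,finite}, 'v::ab_group_add) qmat \<Rightarrow> 'v set \<Rightarrow> bool" where
  "free_separator M A \<longleftrightarrow> A \<in> subspaces M \<and>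
     (\<forall>V\<in>subspaces M. rank M (V \<oplus> A) = rank M V \<or> nullity M (V \<inter> A) = nullity M V)"

context qmat
begin

abbreviation "sep \<equiv> free_separator M"

lemma sep_Sub: "sep A \<Longrightarrow> A \<in> Sub"
  by (simp add: free_separator_def)

lemma sepD: "sep A \<Longrightarrow> V \<in> Sub \<Longrightarrow> r (V \<oplus> A) = r V \<or> nul (V \<inter> A) = nul V"
  by (simp add: free_separator_def)

lemma ssum_absorb2: "A \<in> Sub \<Longrightarrow> B \<in> Sub \<Longrightarrow> B \<subseteq> A \<Longrightarrow> B \<oplus> A = A"
  using ssum_absorb[of A B] by (simp only: ssum_commute)

lemma ssum_E: "V \<in> Sub \<Longrightarrow> V \<oplus> E = E"
  by (rule ssum_absorb2) (simp_all only: E_Sub, simp add: Sub_iff)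

lemma sep_E [simp]: "sep E"
  using ssum_E E_Sub by (auto simp: free_separator_def intro: arg_cong[where f = nul] simp: Sub_iff Int_absorb2)

lemma sep_zero [simp]: "sep {0}"
  unfolding free_separator_def
  using ssum_absorb[OF _ zero_Sub] zero_mem by simp

text \<open>\<open>r (V \<oplus> S) = r V\<close> means that \<open>V\<close> spans
  \<open>S\<close>. This survives enlarging \<open>V\<close> and shrinking \<open>S\<close>; the
  dual condition \<open>nul (V \<inter> S) = nul V\<close>, that \<open>S\<close> contains all the
  nullity of \<open>V\<close>, survives shrinking \<open>V\<close> and enlarging \<open>S\<close>.
  These four rules drive the closure properties of separators.\<close>

lemma spans_mono:
  assumes "V \<in> Sub" "W \<in> Sub" "S \<in> Sub" "V \<subseteq> W" "r (V \<oplus> S) = r V"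
  shows "r (W \<oplus> S) = r W"
proof -
  have "V \<oplus> S \<oplus> W = W \<oplus> S"
    using ssum_absorb2[OF assms(2,1,4)] ssum_commute[of S W] by (simp only: ssum_assoc) (simp only: flip: ssum_assoc)
  then have "r (W \<oplus> S) + r ((V \<oplus> S) \<inter> W) \<le> r V + r W"
    using rank_submod[of "V \<oplus> S" W] assms by auto
  moreover have "r V \<le> r ((V \<oplus> S) \<inter> W)"
    using assms ssum_upper1[of V S] by (intro rank_mono) auto
  moreover have "r W \<le> r (W \<oplus> S)"
    using assms ssum_upper1[of W S] by (intro rank_mono) auto
  ultimately show ?thesis by linarith
qed

lemma spans_antimono:
  assumes "V \<in> Sub" "S \<in> Sub" "T \<in> Sub" "S \<subseteq> T" "r (V \<oplus> T) = r V"
  shows "r (V \<oplus> S) = r V"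
proof -
  have "r (V \<oplus> S) \<le> r (V \<oplus> T)"
    using assms by (intro rank_mono ssum_Sub ssum_mono) auto
  moreover have "r V \<le> r (V \<oplus> S)"
    using assms ssum_upper1[of V S] by (intro rank_mono) auto
  ultimately show ?thesis using assms(5) by linarith
qed

lemma nul_Int_mono:
  assumes "V \<in> Sub" "W \<in> Sub" "S \<in> Sub" "V \<subseteq> W" "nul (W \<inter> S) = nul W"
  shows "nul (V \<inter> S) = nul V"
proof -
  have "V \<inter> (W \<inter> S) = V \<inter> S" using assms(4) by blast
  then have "nul V + nul W \<le> nul (V \<oplus> (W \<inter> S)) + nul (V \<inter> S)"
    using nul_supermod[of V "W \<inter> S"] assms by auto
  moreover have "nul (V \<oplus> (W \<inter> S)) \<le> nul W"
    using assms by (intro nul_mono ssum_Sub Int_Sub ssum_least) auto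
  moreover have "nul (V \<inter> S) \<le> nul V"
    using assms by (intro nul_mono) auto
  ultimately show ?thesis by linarith
qed

lemma nul_Int_antimono:
  assumes "V \<in> Sub" "S \<in> Sub" "T \<in> Sub" "S \<subseteq> T" "nul (V \<inter> S) = nul V"
  shows "nul (V \<inter> T) = nul V"
proof -
  have "nul (V \<inter> S) \<le> nul (V \<inter> T)"
    using assms by (intro nul_mono) auto
  moreover have "nul (V \<inter> T) \<le> nul V"
    using assms by (intro nul_mono) auto
  ultimately show ?thesis using assms(5) by linarith
qed

text \<open>If \<open>V\<close> does not span the intersection, it spans neither \<open>A\<close>
  nor \<open>B\<close>, and its subspace \<open>V \<inter> A\<close> does not span \<open>B\<close>
  either. Cutting with \<open>A\<close> and then with \<open>B\<close> therefore loses no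
  nullity.\<close>

lemma sep_Int:
  assumes A: "sep A" and B: "sep B"
  shows "sep (A \<inter> B)"
  unfolding free_separator_def
proof (intro conjI ballI)
  note S = sep_Sub[OF A] sep_Sub[OF B]
  show AB: "A \<inter> B \<in> Sub" using S by blast
  fix V assume V: "V \<in> Sub"
  have VA: "V \<inter> A \<in> Sub" using V S by blast
  show "r (V \<oplus> (A \<inter> B)) = r V \<or> nul (V \<inter> (A \<inter> B)) = nul V"
  proof (rule ccontr)
    assume neg: "\<not> ?thesis"
    then have "r (V \<oplus> A) \<noteq> r V" "r (V \<oplus> B) \<noteq> r V"
      using spans_antimono[OF V AB S(1)] spans_antimono[OF V AB S(2)] by auto
    then have "nul (V \<inter> A) = nul V" "r ((V \<inter> A) \<oplus> B) \<noteq> r (V \<inter> A)"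
      using sepD[OF A V] spans_mono[OF VA V S(2)] by auto
    then show False
      using sepD[OF B VA] neg by (simp add: Int_assoc)
  qed
qed

text \<open>If \<open>B \<oplus> C\<close> misses part of the nullity of \<open>V\<close>, so do
  \<open>B\<close> and \<open>C\<close>. Hence \<open>V\<close> spans both, and then their
  sum.\<close>

lemma sep_ssum:
  assumes B: "sep B" and C: "sep C"
  shows "sep (B \<oplus> C)"
  unfolding free_separator_def
proof (intro conjI ballI)
  note S = sep_Sub[OF B] sep_Sub[OF C]
  show BC: "B \<oplus> C \<in> Sub" using S by blast
  fix V assume V: "V \<in> Sub"
  have VB: "V \<oplus> B \<in> Sub" using V S by blast
  show "r (V \<oplus> (B \<oplus> C)) = r V \<or> nul (V \<inter> (B \<oplus> C)) = nul V"
  proof (rule ccontr)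
    assume neg: "\<not> ?thesis"
    then have "nul (V \<inter> B) \<noteq> nul V" "nul (V \<inter> C) \<noteq> nul V"
      using nul_Int_antimono[OF V S(1) BC ssum_upper1[OF S]]
        nul_Int_antimono[OF V S(2) BC ssum_upper2[OF S]] by auto
    then have rB: "r (V \<oplus> B) = r V" and rC: "r (V \<oplus> C) = r V"
      using sepD[OF B V] sepD[OF C V] by auto
    have "r (V \<oplus> B \<oplus> C) = r (V \<oplus> B)"
      by (rule spans_mono[OF V VB S(2) ssum_upper1[OF V S(1)] rC])
    then show False using neg rB by (simp add: ssum_assoc)
  qed
qed

text \<open>A space \<open>V\<close> violating the condition for \<open>S\<close> must span
  \<open>A\<close> and have all its nullity in \<open>D\<close>. Then
  \<open>(V \<oplus> A) \<inter> D\<close> would violate it too, so test spaces between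
  \<open>A\<close> and \<open>D\<close> suffice. This is what lifts separators from a minor.\<close>

lemma sep_intermediate:
  assumes A: "sep A" and D: "sep D" and S: "S \<in> Sub" and AS: "A \<subseteq> S" and SD: "S \<subseteq> D"
    and int: "\<And>V. V \<in> Sub \<Longrightarrow> A \<subseteq> V \<Longrightarrow> V \<subseteq> D \<Longrightarrow> r (V \<oplus> S) = r V \<or> nul (V \<inter> S) = nul V"
  shows "sep S"
  unfolding free_separator_def
proof (intro conjI ballI S)
  note SA = sep_Sub[OF A] and SDD = sep_Sub[OF D]
  fix V assume V: "V \<in> Sub"
  show "r (V \<oplus> S) = r V \<or> nul (V \<inter> S) = nul V"
  proof (rule ccontr)
    assume neg: "\<not> ?thesis"
    have rA: "r (V \<oplus> A) = r V"
      using sepD[OF A V] nul_Int_antimono[OF V SA S AS] neg by auto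
    have nD: "nul (V \<inter> D) = nul V"
      using sepD[OF D V] spans_antimono[OF V S SDD SD] neg by auto
    let ?W = "(V \<oplus> A) \<inter> D"
    have VA: "V \<oplus> A \<in> Sub" and VD: "V \<inter> D \<in> Sub" using V SA SDD by blast+
    then have W: "?W \<in> Sub" using SDD by blast
    have "A \<subseteq> ?W" using ssum_upper2[OF V SA] AS SD by blast
    then consider "r (?W \<oplus> S) = r ?W" | "nul (?W \<inter> S) = nul ?W"
      using int[OF W] by blast
    then show False
    proof cases
      case 1
      have "r (V \<oplus> A \<oplus> S) = r (V \<oplus> A)"
        by (rule spans_mono[OF W VA S _ 1]) blast
      moreover have "V \<oplus> A \<oplus> S = V \<oplus> S"
        using ssum_absorb2[OF S SA AS] by (simp add: ssum_assoc)
      ultimately show False using rA neg by simp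
    next
      case 2
      have "nul ((V \<inter> D) \<inter> S) = nul (V \<inter> D)"
        using ssum_upper1[OF V SA] by (intro nul_Int_mono[OF VD W S _ 2]) blast
      moreover have "(V \<inter> D) \<inter> S = V \<inter> S" using SD by blast
      ultimately show False using nD neg by simp
    qed
  qed
qed

text \<open>Uniformity of the minor (M|(B + C))/(B Int C), expressed inside \<open>M\<close>. A
  space that spans both \<open>B\<close> and \<open>C\<close> has full rank; any other has all its
  nullity in one of them, which is the case \<open>mixed\<close>.\<close>

lemma uniform_interval:
  assumes B: "sep B" and C: "sep C" and nBC: "\<not> B \<subseteq> C" and nCB: "\<not> C \<subseteq> B"
    and V: "V \<in> Sub" and lower: "B \<inter> C \<subseteq> V" and upper: "V \<subseteq> B \<oplus> C"
  shows "r V = r (B \<oplus> C) \<or> nul V = nul (B \<inter> C)"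
proof -
  \<comment> \<open>\<open>B\<close> and \<open>C\<close> are quantified afresh so that the two can
    be exchanged in the second use.\<close>
  have mixed: "r V = r (B \<oplus> C) \<or> nul V = nul (B \<inter> C)"
    if B: "sep B" and C: "sep C" and nBC: "\<not> B \<subseteq> C"
      and lower: "B \<inter> C \<subseteq> V" and upper: "V \<subseteq> B \<oplus> C"
      and n: "nul (V \<inter> C) = nul V" for B C
  proof -
    note S = sep_Sub[OF B] sep_Sub[OF C]
    let ?U = "V \<inter> C"
    have U: "?U \<in> Sub" using V S by blast
    have UB: "?U \<oplus> B \<in> Sub" using U S by blast
    have "?U \<inter> B = B \<inter> C" using lower by blast
    then consider "nul V = nul (B \<inter> C)" | "r (?U \<oplus> B) = r ?U"
      using sepD[OF B U] n by auto
    then show ?thesis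
    proof cases
      case 2
      \<comment> \<open>Here \<open>?U\<close> spans \<open>B\<close> without containing it, so
        \<open>?U \<oplus> B\<close> has larger nullity than its trace \<open>?U\<close> on
        \<open>C\<close>. The separator \<open>C\<close> must then be spanned by
        \<open>?U \<oplus> B\<close>, and this forces full rank on \<open>V\<close>.\<close>
      have "(?U \<oplus> B) \<inter> C = ?U \<oplus> (B \<inter> C)"
        by (rule modular_law[OF U S]) blast
      also have "\<dots> = ?U"
        using lower by (intro ssum_absorb[OF U Int_Sub[OF S]]) blast
      finally have i: "(?U \<oplus> B) \<inter> C = ?U" .
      have "nul ?U \<noteq> nul (?U \<oplus> B)"
      proof
        assume "nul ?U = nul (?U \<oplus> B)"
        then have "dim ?U = dim (?U \<oplus> B)" using 2 by (simp add: nullity_def)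
        then have "?U = ?U \<oplus> B" by (rule dim_eq_imp_eq[OF U UB ssum_upper1[OF U S(1)]])
        then show False using ssum_upper2[OF U S(1)] nBC by blast
      qed
      then have "r (?U \<oplus> B \<oplus> C) = r ?U"
        using sepD[OF C UB] i 2 by simp
      moreover have "r (B \<oplus> C) \<le> r (?U \<oplus> B \<oplus> C)"
        using UB S ssum_mono[OF ssum_upper2[OF U S(1)] order_refl] by (intro rank_mono) auto
      moreover have "r ?U \<le> r V" using U V by (intro rank_mono) auto
      moreover have "r V \<le> r (B \<oplus> C)" using V S upper by (intro rank_mono) auto
      ultimately show ?thesis by linarith
    qed blast
  qed
  note S = sep_Sub[OF B] sep_Sub[OF C]
  consider "nul (V \<inter> C) = nul V" | "nul (V \<inter> B) = nul V" | "r (V \<oplus> B) = r V" "r (V \<oplus> C) = r V"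
    using sepD[OF B V] sepD[OF C V] by blast
  then show ?thesis
  proof cases
    case 1
    then show ?thesis using mixed[OF B C nBC lower upper] by blast
  next
    case 2
    then show ?thesis
      using mixed[OF C B nCB] lower upper by (simp add: Int_commute ssum_commute)
  next
    case 3
    have VB: "V \<oplus> B \<in> Sub" using V S by blast
    have "r (V \<oplus> B \<oplus> C) = r (V \<oplus> B)"
      by (rule spans_mono[OF V VB S(2) ssum_upper1[OF V S(1)] 3(2)])
    moreover have "V \<oplus> B \<oplus> C = B \<oplus> C"
      using ssum_absorb2[OF ssum_Sub[OF S] V upper] by (simp add: ssum_assoc)
    ultimately show ?thesis using 3(1) by simp
  qed
qed

section \<open>Covers and maximal chains of separators\<close>

definition cover :: "'v set \<Rightarrow> 'v set \<Rightarrow> bool" where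
  "cover A B \<longleftrightarrow> sep A \<and> sep B \<and> A \<subset> B \<and> (\<forall>S. sep S \<longrightarrow> A \<subseteq> S \<longrightarrow> S \<subseteq> B \<longrightarrow> S = A \<or> S = B)"

lemma exists_cover:
  assumes A: "sep A" and "A \<noteq> E"
  obtains B where "cover A B"
proof -
  let ?F = "{B. sep B \<and> A \<subset> B}"
  have "?F \<subseteq> Pow E" using sep_Sub by (auto simp: Sub_iff)
  then have "finite ?F" by (rule finite_subset) simp
  moreover have "A \<subseteq> E" using sep_Sub[OF A] by (simp add: Sub_iff)
  with assms(2) have "E \<in> ?F" using sep_E by blast
  ultimately obtain B where B: "B \<in> ?F" "\<And>S. S \<in> ?F \<Longrightarrow> S \<subseteq> B \<Longrightarrow> S = B"
    using finite_has_minimal[of ?F] by (metis (no_types, lifting) empty_iff)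
  then have "cover A B" unfolding cover_def using A by blast
  then show thesis by (rule that)
qed

text \<open>The lower end is an argument and not a list entry, so that the entries correspond one to
  one to the factors in \<open>flag_factors\<close>.\<close>

fun flag :: "'v set \<Rightarrow> 'v set list \<Rightarrow> bool" where
  "flag A [] \<longleftrightarrow> A = E"
| "flag A (B # Bs) \<longleftrightarrow> cover A B \<and> flag B Bs"

lemma exists_flag: "sep A \<Longrightarrow> \<exists>Bs. flag A Bs"
proof (induction "card (E - A)" arbitrary: A rule: less_induct)
  case less
  show ?case
  proof (cases "A = E")
    case True
    then show ?thesis by (intro exI[of _ "[]"]) simp
  next
    case False
    then obtain B where B: "cover A B" using exists_cover less.prems by blast
    then have "A \<subset> B" "sep B" by (auto simp: cover_def)
    then have "card (E - B) < card (E - A)"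
      using sep_Sub[of B] unfolding Sub_iff by (intro psubset_card_mono) (simp, blast)
    then obtain Bs where "flag B Bs" using less.hyps \<open>sep B\<close> by blast
    then show ?thesis using B by (intro exI[of _ "B # Bs"]) simp
  qed
qed

text \<open>The equality \<open>r B = r C\<close> is what fixes the order of the factors: by
  uniformity the first step above \<open>A\<close> raises the rank by min(1, r D - r A), whichever
  cover of \<open>A\<close> it reaches.\<close>

lemma diamond:
  assumes AB: "cover A B" and AC: "cover A C" and ne: "B \<noteq> C"
  defines "D \<equiv> B \<oplus> C"
  shows "cover B D" "cover C D" "dim B = dim A + 1" "dim C = dim A + 1" "dim D = dim A + 2" "r B = r C"
proof -
  have sep: "sep A" "sep B" "sep C" and sub: "A \<subset> B" "A \<subset> C"
    using AB AC by (auto simp: cover_def)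
  note S = sep_Sub[OF sep(1)] sep_Sub[OF sep(2)] sep_Sub[OF sep(3)]
  have DS: "D \<in> Sub" unfolding D_def using S by blast
  have nBC: "\<not> B \<subseteq> C" "\<not> C \<subseteq> B"
  proof -
    show "\<not> B \<subseteq> C" using AC sep(2) sub(1) ne unfolding cover_def by (metis less_le)
    show "\<not> C \<subseteq> B" using AB sep(3) sub(2) ne unfolding cover_def by (metis less_le)
  qed
  have BC: "B \<inter> C = A"
  proof -
    have "A \<subseteq> B \<inter> C" "B \<inter> C \<subseteq> B" using sub by auto
    then have "B \<inter> C = A \<or> B \<inter> C = B"
      using AB sep_Int[OF sep(2,3)] unfolding cover_def by simp
    then show ?thesis using nBC by blast
  qed
  have unif: "r V = r D \<or> nul V = nul A" if "V \<in> Sub" "A \<subseteq> V" "V \<subseteq> D" for V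
    using uniform_interval[OF sep(2,3) nBC, of V] that by (simp add: BC D_def)
  have BD: "B \<subseteq> D" and CD: "C \<subseteq> D"
    unfolding D_def using ssum_upper1[OF S(2,3)] ssum_upper2[OF S(2,3)] .
  have sepD': "sep D"
    unfolding D_def by (rule sep_ssum[OF sep(2,3)])
  \<comment> \<open>Full rank survives adding \<open>S\<close>, and the absence of nullity beyond
    that of \<open>A\<close> survives intersecting with \<open>S\<close>; by
    \<open>uniform_interval\<close> one of the two applies to each test space.\<close>
  have sep_any: "sep S" if T: "S \<in> Sub" "A \<subseteq> S" "S \<subseteq> D" for S
  proof (rule sep_intermediate[OF sep(1) sepD' T])
    fix V assume V: "V \<in> Sub" "A \<subseteq> V" "V \<subseteq> D"
    from unif[OF this] show "r (V \<oplus> S) = r V \<or> nul (V \<inter> S) = nul V"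
    proof
      assume "r V = r D"
      then have "r (V \<oplus> S) \<le> r V"
        using V T DS ssum_least[of D V S] rank_mono[of "V \<oplus> S" D] by auto
      moreover have "r V \<le> r (V \<oplus> S)" using V T ssum_upper1 by (intro rank_mono) auto
      ultimately show ?thesis by simp
    next
      assume *: "nul V = nul A"
      have "nul A \<le> nul (V \<inter> S)" using V T S by (intro nul_mono) auto
      moreover have "nul (V \<inter> S) \<le> nul V" using V T by (intro nul_mono) auto
      ultimately show ?thesis using * by simp
    qed
  qed
  \<comment> \<open>The line through a vector of \<open>X\<close> outside \<open>A\<close>, added to
    \<open>A\<close>, is a separator by \<open>sep_any\<close>; the covering relation makes it all
    of \<open>X\<close>.\<close>
  have dim: "dim X = dim A + 1" if X: "cover A X" "X \<subseteq> D" for X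
  proof -
    have XS: "X \<in> Sub" and AX: "A \<subset> X" using X sep_Sub by (auto simp: cover_def)
    obtain x where x: "x \<in> X" "x \<notin> A" using AX by blast
    let ?L = "span {x}"
    have LX: "?L \<subseteq> X" using x XS by (intro span_minimal) (auto simp: Sub_iff)
    have L: "?L \<in> Sub" using LX XS by (auto simp: Sub_iff)
    have AL: "A \<oplus> ?L \<in> Sub" using S L by blast
    have "A \<oplus> ?L \<subseteq> X" using ssum_least[OF XS _ LX] AX by blast
    moreover have "x \<in> A \<oplus> ?L" using ssum_upper2[OF S(1) L] span_base[of x "{x}"] by blast
    moreover have "sep (A \<oplus> ?L)"
      using sep_any[OF AL ssum_upper1[OF S(1) L]] X(2) \<open>A \<oplus> ?L \<subseteq> X\<close> by blast
    ultimately have "X = A \<oplus> ?L"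
      using X(1) ssum_upper1[OF S(1) L] x(2) unfolding cover_def by metis
    moreover have "dim ?L \<le> 1" using dim_le_card[of ?L "{x}"] by simp
    moreover have "dim A \<noteq> dim X" using dim_eq_imp_eq[OF S(1) XS] AX by blast
    ultimately show ?thesis
      using dim_ssum_Int[OF S(1) L] dim_mono[OF S(1) XS] AX by auto
  qed
  show dB: "dim B = dim A + 1" and dC: "dim C = dim A + 1"
    using dim[OF AB BD] dim[OF AC CD] .
  show dD: "dim D = dim A + 2"
    using dim_ssum_Int[OF S(2,3)] dB dC by (simp add: D_def BC)
  have cov: "cover X D" if X: "sep X" "X \<subseteq> D" "dim X = dim A + 1" for X
    unfolding cover_def
  proof (intro conjI allI impI X sepD')
    show "X \<subset> D" using X dD by force
    fix T assume T: "sep T" "X \<subseteq> T" "T \<subseteq> D"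
    note TX = sep_Sub[OF T(1)] sep_Sub[OF X(1)]
    have "dim X \<le> dim T" "dim T \<le> dim D"
      using TX DS T by (auto intro: dim_mono)
    then have "dim X = dim T \<or> dim T = dim D" using X(3) dD by linarith
    then show "T = X \<or> T = D"
      using dim_eq_imp_eq[OF TX(2,1)] dim_eq_imp_eq[OF TX(1) DS] T by blast
  qed
  show "cover B D" "cover C D" using cov sep BD CD dB dC by blast+
  have "r B \<le> r D" "r C \<le> r D" using S DS BD CD by (auto intro: rank_mono)
  moreover have "r B \<le> r A + 1" "r C \<le> r A + 1"
    using rank_increase[OF S(1,2)] rank_increase[OF S(1,3)] sub dB dC by auto
  ultimately show "r B = r C"
    using unif[OF S(2)] unif[OF S(3)] sub BD CD dB dC by (auto simp: nullity_def)
qed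

end

subsection \<open>Minors and the exchange argument\<close>

text \<open>\<open>\<tau>\<close> identifies \<open>X\<close> with the minor \<open>(M|B)/A\<close>, without constructing a quotient space.\<close>

definition minor_map ::
  "('k::{field,finite}, 'v::ab_group_add) qmat \<Rightarrow> 'v set \<Rightarrow> 'v set \<Rightarrow> ('k, 'w::ab_group_add) qmat \<Rightarrow> ('v \<Rightarrow> 'w) \<Rightarrow> bool"
  where "minor_map M A B X \<tau> \<longleftrightarrow>
    lin_on (scal M) (scal X) B \<tau> \<and> \<tau> ` B = ground X \<and> {x \<in> B. \<tau> x = 0} = A \<and>
    (\<forall>V\<in>subspaces M. A \<subseteq> V \<longrightarrow> V \<subseteq> B \<longrightarrow> rank X (\<tau> ` V) = rank M V - rank M A)"

definition minor ::
  "('k::{field,finite}, 'v::ab_group_add) qmat \<Rightarrow> 'v set \<Rightarrow> 'v set \<Rightarrow> ('k, 'w::ab_group_add) qmat \<Rightarrow> bool"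
  where "minor M A B X \<longleftrightarrow> (\<exists>\<tau>. minor_map M A B X \<tau>)"

text \<open>One setting for isomorphisms (\<open>K = {0}\<close>, \<open>L = ground N\<close>),
  restrictions (\<open>K = {0}\<close>) and contractions (\<open>L = ground N\<close>). Image under
  \<open>\<tau>\<close> and \<open>pre\<close> are mutually inverse between the interval from
  \<open>K\<close> to \<open>L\<close> in \<open>N\<close> and the subspaces of
  \<open>P\<close>.\<close>

locale qmat_minor = N: qmat N + P: qmat P
  for N :: "('k::{field,finite}, 'v::ab_group_add) qmat" and P :: "('k, 'w::ab_group_add) qmat" +
  fixes K L :: "'v set" and \<tau> :: "'v \<Rightarrow> 'w"
  assumes K: "K \<in> subspaces N" and L: "L \<in> subspaces N" and map: "minor_map N K L P \<tau>"
begin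

definition pre :: "'w set \<Rightarrow> 'v set" where "pre A = {x \<in> L. \<tau> x \<in> A}"

lemma lin: "lin_on (scal N) (scal P) L \<tau>" and image_L: "\<tau> ` L = ground P"
  and kernel: "{x \<in> L. \<tau> x = 0} = K"
  using map by (simp_all add: minor_map_def)

lemma map_add: "x \<in> L \<Longrightarrow> y \<in> L \<Longrightarrow> \<tau> (x + y) = \<tau> x + \<tau> y"
  and map_scale: "x \<in> L \<Longrightarrow> \<tau> (scal N c x) = scal P c (\<tau> x)"
  using lin by (simp_all add: lin_on_def)

lemma map_diff: "x \<in> L \<Longrightarrow> y \<in> L \<Longrightarrow> \<tau> (x - y) = \<tau> x - \<tau> y"
  using map_add[of "x - y" y] L N.subspace_diff[of L x y] by (simp add: N.Sub_iff)

lemma K_le_L: "K \<subseteq> L"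
  using kernel by blast

lemma image_subset: "V \<subseteq> L \<Longrightarrow> \<tau> ` V \<subseteq> ground P"
  using image_L by blast

lemma image_Sub: "V \<in> subspaces N \<Longrightarrow> V \<subseteq> L \<Longrightarrow> \<tau> ` V \<in> subspaces P"
  using subspace_image[OF N.vector_space_axioms P.vector_space_axioms _ lin_on_mono[OF lin]]
    image_subset by (simp add: N.Sub_iff P.Sub_iff)

lemma pre_Sub: "A \<in> subspaces P \<Longrightarrow> pre A \<in> subspaces N"
  using subspace_preimage[OF N.vector_space_axioms P.vector_space_axioms _ lin] L
  by (auto simp: N.Sub_iff P.Sub_iff pre_def)

lemma pre_le_L: "pre A \<subseteq> L"
  by (auto simp: pre_def)

lemma K_le_pre: "A \<in> subspaces P \<Longrightarrow> K \<subseteq> pre A"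
  using P.zero_mem kernel by (auto simp: pre_def)

lemma image_pre: "A \<subseteq> ground P \<Longrightarrow> \<tau> ` pre A = A"
  using image_L by (force simp: pre_def)

lemma pre_image:
  assumes V: "V \<in> subspaces N" "K \<subseteq> V" "V \<subseteq> L"
  shows "pre (\<tau> ` V) = V"
proof
  show "pre (\<tau> ` V) \<subseteq> V"
  proof
    fix x assume "x \<in> pre (\<tau> ` V)"
    then obtain v where v: "x \<in> L" "v \<in> V" "\<tau> x = \<tau> v" by (auto simp: pre_def)
    have vL: "v \<in> L" using v V by blast
    have "x - v \<in> L"
      using L N.subspace_diff[OF _ v(1) vL] by (simp add: N.Sub_iff)
    moreover have "\<tau> (x - v) = 0" using map_diff[OF v(1) vL] v(3) by simp
    ultimately have "x - v \<in> V" using kernel V(2) by blast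
    then show "x \<in> V" using N.subspace_add[of V "x - v" v] v V(1) by (simp add: N.Sub_iff)
  qed
  show "V \<subseteq> pre (\<tau> ` V)" using V by (auto simp: pre_def)
qed

lemma rank_image:
  "V \<in> subspaces N \<Longrightarrow> K \<subseteq> V \<Longrightarrow> V \<subseteq> L \<Longrightarrow> rank P (\<tau> ` V) = rank N V - rank N K"
  using map by (simp add: minor_map_def)

lemma dim_image:
  assumes V: "V \<in> subspaces N" "K \<subseteq> V" "V \<subseteq> L"
  shows "N.dim V = N.dim K + P.dim (\<tau> ` V)"
proof -
  have "{x \<in> V. \<tau> x = 0} = K" using kernel V(2,3) by blast
  then show ?thesis
    using dim_kernel_image[OF N.vector_space_axioms P.vector_space_axioms _ N.finite_Sub[OF V(1)]
        lin_on_mono[OF lin V(3)]] V(1) by (simp add: N.Sub_iff)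
qed

lemma nullity_image:
  "V \<in> subspaces N \<Longrightarrow> K \<subseteq> V \<Longrightarrow> V \<subseteq> L \<Longrightarrow> nullity P (\<tau> ` V) = nullity N V - nullity N K"
  using rank_image[of V] dim_image[of V] by (simp add: nullity_def)

lemma image_ssum: "V \<subseteq> L \<Longrightarrow> W \<subseteq> L \<Longrightarrow> \<tau> ` (V \<oplus> W) = \<tau> ` V \<oplus> \<tau> ` W"
  unfolding ssum_def by (force simp: map_add subset_iff)

lemma image_Int_pre: "V \<subseteq> L \<Longrightarrow> \<tau> ` (V \<inter> pre A) = \<tau> ` V \<inter> A"
  by (auto simp: pre_def)

text \<open>On the interval, rank and nullity in \<open>N\<close> differ from those of the image by
  the constants of \<open>K\<close>, which cancel in each equation.\<close>

lemma separation_transfer: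
  assumes V: "V \<in> subspaces N" "K \<subseteq> V" "V \<subseteq> L" and S: "S \<in> subspaces N" "K \<subseteq> S" "S \<subseteq> L"
  shows "rank P (\<tau> ` V \<oplus> \<tau> ` S) = rank P (\<tau> ` V) \<longleftrightarrow> rank N (V \<oplus> S) = rank N V"
    and "nullity P (\<tau> ` V \<inter> \<tau> ` S) = nullity P (\<tau> ` V) \<longleftrightarrow> nullity N (V \<inter> S) = nullity N V"
proof -
  have VS: "V \<oplus> S \<in> subspaces N" "V \<inter> S \<in> subspaces N" using V S by blast+
  have "K \<subseteq> V \<oplus> S" using N.ssum_upper1[OF V(1) S(1)] V(2) by blast
  moreover have "V \<oplus> S \<subseteq> L" by (rule N.ssum_least[OF L V(3) S(3)])
  ultimately show "rank P (\<tau> ` V \<oplus> \<tau> ` S) = rank P (\<tau> ` V) \<longleftrightarrow> rank N (V \<oplus> S) = rank N V"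
    using rank_image[OF VS(1)] rank_image[OF V] image_ssum[OF V(3) S(3)] by simp
  have "\<tau> ` V \<inter> \<tau> ` S = \<tau> ` (V \<inter> S)"
    using image_Int_pre[OF V(3), of "\<tau> ` S"] pre_image[OF S] by simp
  then show "nullity P (\<tau> ` V \<inter> \<tau> ` S) = nullity P (\<tau> ` V) \<longleftrightarrow> nullity N (V \<inter> S) = nullity N V"
    using nullity_image[OF VS(2)] nullity_image[OF V] V(2,3) S(2) by (simp add: le_infI1)
qed

lemma sep_image:
  assumes S: "free_separator N S" "K \<subseteq> S" "S \<subseteq> L"
  shows "free_separator P (\<tau> ` S)"
  unfolding free_separator_def
proof (intro conjI ballI)
  note SS = N.sep_Sub[OF S(1)]
  show "\<tau> ` S \<in> subspaces P" by (rule image_Sub[OF SS S(3)])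
  fix V assume V: "V \<in> subspaces P"
  have "\<tau> ` pre V = V" using V image_pre by (simp add: P.Sub_iff)
  then show "rank P (V \<oplus> \<tau> ` S) = rank P V \<or> nullity P (V \<inter> \<tau> ` S) = nullity P V"
    using separation_transfer[OF pre_Sub[OF V] K_le_pre[OF V] pre_le_L SS S(2,3)]
      N.sepD[OF S(1) pre_Sub[OF V]] by simp
qed

text \<open>\<open>P\<close> only sees test spaces between \<open>K\<close> and \<open>L\<close>.
  That these suffice is \<open>sep_intermediate\<close>, whence the condition that \<open>K\<close>
  and \<open>L\<close> be separators, which \<open>sep_image\<close> does without.\<close>

lemma sep_pre:
  assumes KL: "free_separator N K" "free_separator N L" and S: "free_separator P S"
  shows "free_separator N (pre S)"
proof (rule N.sep_intermediate[OF KL])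
  note SS = P.sep_Sub[OF S]
  show "pre S \<in> subspaces N" by (rule pre_Sub[OF SS])
  show "K \<subseteq> pre S" by (rule K_le_pre[OF SS])
  show "pre S \<subseteq> L" by (rule pre_le_L)
  fix V assume V: "V \<in> subspaces N" "K \<subseteq> V" "V \<subseteq> L"
  have "\<tau> ` pre S = S" using SS image_pre by (simp add: P.Sub_iff)
  then show "rank N (V \<oplus> pre S) = rank N V \<or> nullity N (V \<inter> pre S) = nullity N V"
    using separation_transfer[OF V pre_Sub[OF SS] K_le_pre[OF SS] pre_le_L]
      P.sepD[OF S image_Sub[OF V(1,3)]] by simp
qed

text \<open>A minor of a minor is a minor of the ambient q-matroid; this lets flags of
  \<open>P\<close> keep their labels when pulled back to \<open>N\<close>.\<close>

lemma minor_map_comp: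
  assumes A: "A \<in> subspaces P" and B: "B \<in> subspaces P" and AB: "A \<subseteq> B"
    and \<sigma>: "minor_map P A B X \<sigma>"
  shows "minor_map N (pre A) (pre B) X (\<sigma> \<circ> \<tau>)"
  unfolding minor_map_def
proof (intro conjI ballI impI)
  have BE: "B \<subseteq> ground P" using B by (simp add: P.Sub_iff)
  have \<sigma>: "lin_on (scal P) (scal X) B \<sigma>" "\<sigma> ` B = ground X" "{x \<in> B. \<sigma> x = 0} = A"
    and r\<sigma>: "\<And>V. V \<in> subspaces P \<Longrightarrow> A \<subseteq> V \<Longrightarrow> V \<subseteq> B \<Longrightarrow> rank X (\<sigma> ` V) = rank P V - rank P A"
    using \<sigma> by (simp_all add: minor_map_def)
  show "lin_on (scal N) (scal X) (pre B) (\<sigma> \<circ> \<tau>)"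
    using \<sigma>(1) by (auto simp: lin_on_def pre_def map_add map_scale)
  show "(\<sigma> \<circ> \<tau>) ` pre B = ground X"
    using image_pre[OF BE] \<sigma>(2) by (simp only: image_comp[symmetric])
  show "{x \<in> pre B. (\<sigma> \<circ> \<tau>) x = 0} = pre A"
    using \<sigma>(3) AB by (auto simp: pre_def)
  fix V assume V: "V \<in> subspaces N" "pre A \<subseteq> V" "V \<subseteq> pre B"
  have KV: "K \<subseteq> V" "V \<subseteq> L" using V K_le_pre[OF A] pre_le_L[of B] by blast+
  have AE: "A \<subseteq> ground P" using A by (simp add: P.Sub_iff)
  have "A \<subseteq> \<tau> ` V" using image_mono[OF V(2), of \<tau>] image_pre[OF AE] by simp
  moreover have "\<tau> ` V \<subseteq> B" using image_mono[OF V(3), of \<tau>] image_pre[OF BE] by simp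
  ultimately have "rank X (\<sigma> ` \<tau> ` V) = rank P (\<tau> ` V) - rank P A"
    using r\<sigma> image_Sub[OF V(1) KV(2)] by blast
  then show "rank X ((\<sigma> \<circ> \<tau>) ` V) = rank N V - rank N (pre A)"
    using rank_image[OF V(1) KV] rank_image[OF pre_Sub[OF A] K_le_pre[OF A] pre_le_L]
      image_pre[OF AE] by (simp only: image_comp[symmetric])
qed

end

section \<open>One-dimensional minors and uniqueness of minors\<close>

context qmat
begin

text \<open>The scalar is the coordinate of \<open>x\<close> in the line C/A with respect to the
  class of \<open>c\<close>. As a function of \<open>x\<close> it is a linear functional on
  \<open>C\<close> with kernel \<open>A\<close>.\<close>

lemma hyperplane_coordinate:
  assumes A: "A \<in> Sub" and C: "C \<in> Sub" and AC: "A \<subseteq> C" and dim: "dim C = dim A + 1"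
    and c: "c \<in> C" "c \<notin> A" and x: "x \<in> C"
  shows "\<exists>!k. x - scal M k c \<in> A"
proof -
  let ?L = "span {c}"
  have LC: "?L \<subseteq> C" using c C by (intro span_minimal) (auto simp: Sub_iff)
  have L: "?L \<in> Sub" using LC C by (auto simp: Sub_iff)
  have AL: "A \<oplus> ?L \<in> Sub" "A \<oplus> ?L \<subseteq> C" "A \<subseteq> A \<oplus> ?L"
    using ssum_Sub[OF A L] ssum_least[OF C AC LC] ssum_upper1[OF A L] .
  have "c \<in> A \<oplus> ?L" using ssum_upper2[OF A L] span_base[of c "{c}"] by blast
  then have "dim A \<noteq> dim (A \<oplus> ?L)" using dim_eq_imp_eq[OF A AL(1,3)] c(2) by blast
  then have "dim (A \<oplus> ?L) = dim C"
    using dim dim_mono[OF A AL(1,3)] dim_mono[OF AL(1) C AL(2)] by linarith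
  then have "A \<oplus> ?L = C" using dim_eq_imp_eq[OF AL(1) C AL(2)] by blast
  then obtain a l where al: "x = a + l" "a \<in> A" "l \<in> ?L" using x unfolding ssum_def by blast
  then obtain k where "l = scal M k c" by (auto simp: span_singleton)
  then have k: "x - scal M k c \<in> A" using al by simp
  moreover have "k' = k" if k': "x - scal M k' c \<in> A" for k'
  proof (rule ccontr)
    assume ne: "k' \<noteq> k"
    have "(x - scal M k c) - (x - scal M k' c) \<in> A"
      using A by (intro subspace_diff k k') (simp add: Sub_iff)
    then have "scal M (k' - k) c \<in> A" by (simp add: scale_left_diff_distrib)
    then have "scal M (inverse (k' - k)) (scal M (k' - k) c) \<in> A"
      using subspace_scale[of A] A unfolding Sub_iff by blast
    then show False using ne c(2) by simp
  qed
  ultimately show ?thesis by blast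
qed

text \<open>A one-dimensional q-matroid is determined by its rank. So any linear map of
  \<open>C\<close> onto the ground space of \<open>X\<close> with kernel \<open>A'\<close> works: no
  subspace lies strictly between \<open>A'\<close> and \<open>C\<close>, and at the two ends the
  ranks agree by assumption.\<close>

lemma minor_transfer_dim_1:
  assumes X: "qmatroid X"
    and A: "A \<in> Sub" and B: "B \<in> Sub" and AB: "A \<subseteq> B" and dB: "dim B = dim A + 1"
    and A': "A' \<in> Sub" and C: "C \<in> Sub" and AC: "A' \<subseteq> C" and dC: "dim C = dim A' + 1"
    and rank: "r B - r A = r C - r A'" and minor: "minor M A B X"
  shows "minor M A' C X"
proof -
  interpret X: qmat X by unfold_locales fact
  obtain \<tau> where \<tau>: "minor_map M A B X \<tau>" using minor by (auto simp: minor_def)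
  interpret T: qmat_minor M X A B \<tau> by unfold_locales fact+
  have "A \<noteq> B" "A' \<noteq> C" using dB dC by auto
  then obtain b c where b: "b \<in> B" "b \<notin> A" and c: "c \<in> C" "c \<notin> A'" using AB AC by blast
  define \<kappa> where "\<kappa> x = (THE k. x - scal M k c \<in> A')" for x
  have \<kappa>_iff: "x - scal M k c \<in> A' \<longleftrightarrow> \<kappa> x = k" if "x \<in> C" for x k
    using theI'[OF hyperplane_coordinate[OF A' C AC dC c that]]
      hyperplane_coordinate[OF A' C AC dC c that] unfolding \<kappa>_def by blast
  have sA': "subspace A'" and sC: "subspace C" using A' C by (auto simp: Sub_iff)
  have \<kappa>_add: "\<kappa> (x + y) = \<kappa> x + \<kappa> y" if "x \<in> C" "y \<in> C" for x y
  proof -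
    have "(x - scal M (\<kappa> x) c) + (y - scal M (\<kappa> y) c) \<in> A'"
      using that \<kappa>_iff subspace_add[OF sA'] by blast
    then have "(x + y) - scal M (\<kappa> x + \<kappa> y) c \<in> A'"
      by (simp add: scale_left_distrib algebra_simps)
    then show ?thesis using \<kappa>_iff subspace_add[OF sC that] by blast
  qed
  have \<kappa>_scale: "\<kappa> (scal M l x) = l * \<kappa> x" if "x \<in> C" for l x
  proof -
    have "scal M l (x - scal M (\<kappa> x) c) \<in> A'"
      using that \<kappa>_iff subspace_scale[OF sA'] by blast
    then have "scal M l x - scal M (l * \<kappa> x) c \<in> A'"
      by (simp add: scale_right_diff_distrib)
    then show ?thesis using \<kappa>_iff subspace_scale[OF sC that] by blast
  qed
  have \<kappa>_c: "\<kappa> (scal M k c) = k" for k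
    using \<kappa>_iff[OF subspace_scale[OF sC c(1)], of k k] subspace_0[OF sA'] by simp
  have \<kappa>_0: "\<kappa> x = 0 \<longleftrightarrow> x \<in> A'" if "x \<in> C" for x
    using \<kappa>_iff[OF that, of 0] by simp
  have b0: "\<tau> b \<noteq> 0" using b T.kernel by blast
  \<comment> \<open>The class of \<open>c\<close> is sent to \<open>\<tau> b\<close>, which spans
    the ground space of \<open>X\<close>.\<close>
  let ?\<sigma> = "\<lambda>x. scal X (\<kappa> x) (\<tau> b)"
  have image: "?\<sigma> ` C = ground X"
  proof
    show "?\<sigma> ` C \<subseteq> ground X"
      using T.image_subset[of B] b(1) X.E_Sub X.subspace_scale[of "ground X"]
      by (auto simp: X.Sub_iff)
    show "ground X \<subseteq> ?\<sigma> ` C"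
    proof
      fix y assume "y \<in> ground X"
      then obtain x where x: "x \<in> B" "y = \<tau> x" using T.image_L by blast
      obtain k where k: "x - scal M k b \<in> A"
        using hyperplane_coordinate[OF A B AB dB b x(1)] by blast
      have kb: "scal M k b \<in> B" using B b subspace_scale by (simp add: Sub_iff)
      have "\<tau> (x - scal M k b) = 0" using k T.kernel by blast
      then have "y = scal X k (\<tau> b)"
        using T.map_diff[OF x(1) kb] T.map_scale[OF b(1)] x(2) by simp
      then have "y = ?\<sigma> (scal M k c)" by (simp add: \<kappa>_c)
      then show "y \<in> ?\<sigma> ` C" using subspace_scale[OF sC c(1)] by blast
    qed
  qed
  have "minor_map M A' C X ?\<sigma>"
    unfolding minor_map_def
  proof (intro conjI ballI impI image)
    show "lin_on (scal M) (scal X) C ?\<sigma>"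
      by (simp add: lin_on_def \<kappa>_add \<kappa>_scale X.scale_left_distrib)
    show "{x \<in> C. ?\<sigma> x = 0} = A'"
      using b0 \<kappa>_0 AC by auto
    fix V assume V: "V \<in> Sub" "A' \<subseteq> V" "V \<subseteq> C"
    have "dim A' \<le> dim V" "dim V \<le> dim C" using dim_mono A' C V by blast+
    then have "dim A' = dim V \<or> dim V = dim C" using dC by linarith
    then consider "V = A'" | "V = C"
      using dim_eq_imp_eq[OF A' V(1,2)] dim_eq_imp_eq[OF V(1) C V(3)] by blast
    then show "rank X (?\<sigma> ` V) = r V - r A'"
    proof cases
      case 1
      have "?\<sigma> ` A' = {0}" using \<kappa>_0 AC subspace_0[OF sA'] by force
      then show ?thesis using 1 X.rank_zero by simp
    next
      case 2
      then show ?thesis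
        using T.rank_image[OF B AB order_refl] rank image T.image_L by simp
    qed
  qed
  then show ?thesis unfolding minor_def by blast
qed

text \<open>Both maps have kernel \<open>A\<close> on \<open>B\<close>, so they identify the same
  vectors, and \<open>\<sigma>\<close> factors through \<open>\<tau>\<close>.\<close>

lemma minor_unique:
  assumes X: "qmatroid X" and Y: "qmatroid Y" and A: "A \<in> Sub" and B: "B \<in> Sub"
    and mX: "minor M A B X" and mY: "minor M A B Y"
  shows "X \<cong>\<^sub>q Y"
proof -
  interpret X: qmat X by unfold_locales fact
  interpret Y: qmat Y by unfold_locales fact
  obtain \<tau> \<sigma> where \<tau>: "minor_map M A B X \<tau>" and \<sigma>: "minor_map M A B Y \<sigma>"
    using mX mY by (auto simp: minor_def)
  interpret T: qmat_minor M X A B \<tau> by unfold_locales fact+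
  interpret S: qmat_minor M Y A B \<sigma> by unfold_locales fact+
  have sB: "subspace B" using B by (simp add: Sub_iff)
  have eq_iff: "\<tau> x = \<tau> y \<longleftrightarrow> \<sigma> x = \<sigma> y" if "x \<in> B" "y \<in> B" for x y
  proof -
    have "\<tau> x = \<tau> y \<longleftrightarrow> x - y \<in> A" 
      using T.map_diff[OF that] T.kernel subspace_diff[OF sB that] by auto
    also have "\<dots> \<longleftrightarrow> \<sigma> x = \<sigma> y"
      using S.map_diff[OF that] S.kernel subspace_diff[OF sB that] by auto
    finally show ?thesis .
  qed
  \<comment> \<open>The preimage chosen by \<open>inv_into\<close> is immaterial by
    \<open>eq_iff\<close>.\<close>
  define \<rho> where "\<rho> y = \<sigma> (inv_into B \<tau> y)" for y
  have \<rho>: "\<rho> (\<tau> x) = \<sigma> x" if "x \<in> B" for x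
    using eq_iff[OF _ that, of "inv_into B \<tau> (\<tau> x)"] that
    by (simp add: \<rho>_def inv_into_into f_inv_into_f)
  have mem: "\<exists>x\<in>B. y = \<tau> x" if "y \<in> ground X" for y using that T.image_L by blast
  have \<rho>_image: "\<rho> ` \<tau> ` W = \<sigma> ` W" if "W \<subseteq> B" for W
    unfolding image_image using \<rho> that by (intro image_cong refl) blast
  have "\<rho> ` ground X = ground Y"
    using \<rho>_image[OF order_refl] by (simp only: T.image_L S.image_L)
  moreover have "inj_on \<rho> (ground X)"
    unfolding T.image_L[symmetric] by (auto simp: inj_on_def \<rho> eq_iff)
  ultimately have "bij_betw \<rho> (ground X) (ground Y)" by (simp add: bij_betw_def)
  moreover have "\<rho> (x + y) = \<rho> x + \<rho> y" if xy: "x \<in> ground X" "y \<in> ground X" for x y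
  proof -
    obtain u v where "u \<in> B" "x = \<tau> u" "v \<in> B" "y = \<tau> v" using mem xy by blast
    then show ?thesis
      using \<rho>[OF subspace_add[OF sB, of u v]] by (simp add: \<rho> T.map_add S.map_add)
  qed
  moreover have "\<rho> (scal X c x) = scal Y c (\<rho> x)" if x: "x \<in> ground X" for x c
  proof -
    obtain u where "u \<in> B" "x = \<tau> u" using mem x by blast
    then show ?thesis
      using \<rho>[OF subspace_scale[OF sB, of u c]] by (simp add: \<rho> T.map_scale S.map_scale)
  qed
  moreover have "rank Y (\<rho> ` V) = rank X V" if V: "V \<in> subspaces X" for V
  proof -
    have W: "T.pre V \<in> Sub" "A \<subseteq> T.pre V" "T.pre V \<subseteq> B"
      using T.pre_Sub T.K_le_pre T.pre_le_L V by blast+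
    have "V = \<tau> ` T.pre V" using T.image_pre V by (simp add: X.Sub_iff)
    moreover have "\<rho> ` \<tau> ` T.pre V = \<sigma> ` T.pre V" by (rule \<rho>_image[OF W(3)])
    ultimately show ?thesis using T.rank_image[OF W] S.rank_image[OF W] by simp
  qed
  ultimately show ?thesis unfolding qmat_iso_def by blast
qed

section \<open>Labelling flags by factors\<close>

fun flag_factors :: "'v set \<Rightarrow> 'v set list \<Rightarrow> ('k, 'w::ab_group_add) qmat list \<Rightarrow> bool" where
  "flag_factors A [] [] \<longleftrightarrow> True"
| "flag_factors A (B # Bs) (X # Xs) \<longleftrightarrow> minor M A B X \<and> flag_factors B Bs Xs"
| "flag_factors A _ _ \<longleftrightarrow> False"

lemma not_cover_E: "\<not> cover E B"
  using sep_Sub[of B] by (auto simp: cover_def Sub_iff)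

text \<open>
  The Jordan-Hoelder exchange. No permutation of the factors occurs because the two steps of a
  diamond have isomorphic counterparts in the same order.
\<close>

lemma flag_factors_unique:
  assumes "\<forall>X\<in>set Xs. qmatroid X" "flag A Bs" "flag A Cs" "flag_factors A Bs Xs"
  shows "flag_factors A Cs Xs"
  using assms
\<comment> \<open>Induction on the labels, since the two flags are not yet known to have equal
  length.\<close>
proof (induction Xs arbitrary: A Bs Cs)
  case Nil
  then have "Bs = []" by (cases Bs) auto
  then have "A = E" using Nil.prems by simp
  then have "Cs = []" using Nil.prems not_cover_E by (cases Cs) auto
  then show ?case by simp
next
  case (Cons X Xs)
  obtain B Bs' where Bs: "Bs = B # Bs'" using Cons.prems by (cases Bs) auto
  have AB: "cover A B" and B: "flag B Bs'" "minor M A B X" "flag_factors B Bs' Xs"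
    using Cons.prems by (auto simp: Bs)
  obtain C Cs' where Cs: "Cs = C # Cs'"
    using Cons.prems AB not_cover_E by (cases Cs) auto
  have AC: "cover A C" and C: "flag C Cs'" using Cons.prems by (auto simp: Cs)
  have X: "qmatroid X" and Xs: "\<forall>X\<in>set Xs. qmatroid X" using Cons.prems by auto
  show ?case
  proof (cases "B = C")
    case True
    then show ?thesis using Cons.IH[OF Xs B(1) _ B(3), of Cs'] B C by (simp add: Cs)
  next
    case False
    define D where "D = B \<oplus> C"
    note d = diamond[OF AB AC False, folded D_def]
    \<comment> \<open>A flag above \<open>D\<close> extends to one from \<open>B\<close> and to one
      from \<open>C\<close>. The induction hypothesis at \<open>B\<close> moves the labels onto the
      first; after the exchange, the hypothesis at \<open>C\<close> moves them from the second onto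
      \<open>Cs'\<close>.\<close>
    obtain Ds where Ds: "flag D Ds" using exists_flag[of D] d(1) unfolding cover_def by blast
    have "flag_factors B (D # Ds) Xs"
      by (rule Cons.IH[OF Xs B(1) _ B(3)]) (simp add: d Ds)
    then obtain Y Ys where Ys: "Xs = Y # Ys" "minor M B D Y" "flag_factors D Ds Ys"
      by (cases Xs) auto
    have S: "A \<in> Sub" "B \<in> Sub" "C \<in> Sub" "D \<in> Sub"
      and sub: "A \<subseteq> B" "A \<subseteq> C" "B \<subseteq> D" "C \<subseteq> D"
      using AB AC d(1,2) by (simp_all add: cover_def sep_Sub less_imp_le)
    \<comment> \<open>Since \<open>r B = r C\<close>, the steps from \<open>B\<close> and from
      \<open>C\<close> up to \<open>D\<close> have the same rank increase, and so do the steps from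
      \<open>A\<close> to \<open>B\<close> and to \<open>C\<close>.\<close>
    have "minor M C D Y"
      using minor_transfer_dim_1[OF _ S(2,4) sub(3) _ S(3,4) sub(4) _ _ Ys(2)] Xs d(3-6)
      by (simp add: Ys(1))
    then have "flag_factors C Cs' Xs"
      by (intro Cons.IH[OF Xs _ C, of "D # Ds"]) (simp_all add: d Ds Ys)
    moreover have "minor M A C X"
      using minor_transfer_dim_1[OF X S(1,2) sub(1) _ S(1,3) sub(2) _ _ B(2)] d(3-6) by simp
    ultimately show ?thesis by (simp add: Cs)
  qed
qed

lemma flag_factors_iso:
  assumes "flag A Bs" "\<forall>X\<in>set Xs. qmatroid X" "\<forall>Y\<in>set Ys. qmatroid Y"
    "flag_factors A Bs Xs" "flag_factors A Bs Ys"
  shows "list_all2 qmat_iso Xs Ys"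
  using assms
proof (induction Bs arbitrary: A Xs Ys)
  case Nil
  then show ?case by (cases Xs; cases Ys) auto
next
  case (Cons B Bs)
  obtain X Xs' where Xs: "Xs = X # Xs'" using Cons.prems by (cases Xs) auto
  obtain Y Ys' where Ys: "Ys = Y # Ys'" using Cons.prems by (cases Ys) auto
  have "A \<in> Sub" "B \<in> Sub" using Cons.prems(1) sep_Sub by (auto simp: cover_def)
  then have "X \<cong>\<^sub>q Y" using minor_unique[of X Y A B] Cons.prems by (simp add: Xs Ys)
  then show ?case using Cons.IH[of B Xs' Ys'] Cons.prems by (simp add: Xs Ys)
qed

section \<open>Spaces of prescribed dimension and maximal independent spaces\<close>

lemma exists_intermediate_dim:
  assumes A: "A \<in> Sub" and B: "B \<in> Sub" and AB: "A \<subseteq> B" and n: "dim A \<le> n" "n \<le> dim B"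
  obtains C where "C \<in> Sub" "A \<subseteq> C" "C \<subseteq> B" "dim C = n"
proof -
  obtain b where b: "b \<subseteq> A" "independent b" "A \<subseteq> span b" "card b = dim A"
    using basis_exists by blast
  obtain c where c: "b \<subseteq> c" "c \<subseteq> B" "independent c" "B \<subseteq> span c"
    using maximal_independent_subset_extend[of b B] b AB by blast
  have fc: "finite c" using c(2) B finite_Sub finite_subset by blast
  have "card c = dim B" using basis_card_eq_dim c by blast
  then obtain d where d: "b \<subseteq> d" "d \<subseteq> c" "card d = n"
    using exists_subset_between[of b n c] b(4) n c(1) fc by auto
  have dB: "span d \<subseteq> B" using d(2) c(2) B span_minimal[of d B] by (auto simp: Sub_iff)
  show thesis
  proof (rule that[of "span d"])
    show "span d \<in> Sub" using dB B by (auto simp: Sub_iff)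
    show "A \<subseteq> span d" using b(3) span_mono[OF d(1)] by blast
    show "dim (span d) = n"
      using dim_span_eq_card_independent[OF independent_mono[OF c(3) d(2)]] d(3) by simp
  qed fact
qed

lemma exists_indep:
  assumes V: "V \<in> Sub"
  obtains I where "indep M I" "I \<subseteq> V" "int (dim I) = r V"
proof -
  let ?F = "{I. indep M I \<and> I \<subseteq> V}"
  have "?F \<subseteq> Pow E" by (auto simp: indep_def Sub_iff)
  then have "finite ?F" by (rule finite_subset) simp
  moreover have "{dim I |I. indep M I \<and> I \<subseteq> V} = dim ` ?F" by blast
  ultimately have fin: "finite {dim I |I. indep M I \<and> I \<subseteq> V}" by simp
  have "indep M {0}" by (simp add: indep_def)
  then have "{dim I |I. indep M I \<and> I \<subseteq> V} \<noteq> {}" using zero_mem[OF V] by blast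
  then have "Max {dim I |I. indep M I \<and> I \<subseteq> V} \<in> {dim I |I. indep M I \<and> I \<subseteq> V}"
    by (rule Max_in[OF fin])
  then show thesis using that rank_eq_Max_indep[OF qmatroid V] by (smt (verit) mem_Collect_eq)
qed

end

subsection \<open>The rank function of a free product\<close>

locale free_prod = M1: qmat M\<^sub>1 + M2: qmat M\<^sub>2
  for M\<^sub>1 :: "('k::{field,finite}, 'v::ab_group_add) qmat" and M\<^sub>2 :: "('k, 'w::ab_group_add) qmat"
begin

text \<open>
  A \<open>q\<close>-matroid of rank \<open>0\<close> on \<open>E\<^sub>1 \<oplus> E\<^sub>2\<close>: it makes the facts on subspaces in the locale \<open>qmat\<close>
  available before the free product is known to be a \<open>q\<close>-matroid.
\<close>

definition Z :: "('k, 'v \<times> 'w) qmat" where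
  "Z = \<lparr>scal = scal (M\<^sub>1 \<box> M\<^sub>2), ground = ground M\<^sub>1 \<times> ground M\<^sub>2, rank = (\<lambda>_. 0)\<rparr>"

lemma vector_space_P: "vector_space (scal (M\<^sub>1 \<box> M\<^sub>2))"
proof -
  interpret vector_space_prod "scal M\<^sub>1" "scal M\<^sub>2" ..
  show ?thesis using p.vector_space_axioms by (simp add: free_product_def)
qed

lemma scal_P: "scal (M\<^sub>1 \<box> M\<^sub>2) c z = (scal M\<^sub>1 c (fst z), scal M\<^sub>2 c (snd z))"
proof -
  interpret vector_space_prod "scal M\<^sub>1" "scal M\<^sub>2" ..
  show ?thesis by (simp add: free_product_def scale_def)
qed

lemma ground_P: "ground (M\<^sub>1 \<box> M\<^sub>2) = ground M\<^sub>1 \<times> ground M\<^sub>2"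
  by (simp add: free_product_def)

lemma Times_subspace:
  "A \<in> M1.Sub \<Longrightarrow> B \<in> M2.Sub \<Longrightarrow> module.subspace (scal (M\<^sub>1 \<box> M\<^sub>2)) (A \<times> B)"
proof -
  assume "A \<in> M1.Sub" "B \<in> M2.Sub"
  interpret vector_space_prod "scal M\<^sub>1" "scal M\<^sub>2" ..
  show ?thesis
    using subspace_Times[of A B] \<open>A \<in> M1.Sub\<close> \<open>B \<in> M2.Sub\<close>
    by (simp add: free_product_def M1.Sub_iff M2.Sub_iff)
qed

sublocale Z: qmat Z
proof
  interpret vector_space "scal (M\<^sub>1 \<box> M\<^sub>2)" by (rule vector_space_P)
  have "span (ground M\<^sub>1 \<times> ground M\<^sub>2) = ground M\<^sub>1 \<times> ground M\<^sub>2"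
    using Times_subspace[OF M1.E_Sub M2.E_Sub] by (simp only: span_eq_iff)
  then have "\<exists>B. finite B \<and> ground M\<^sub>1 \<times> ground M\<^sub>2 = span B"
    by (metis finite_cartesian_product M1.finite_E M2.finite_E)
  then show "qmatroid Z" using vector_space_axioms by (simp add: qmatroid_def Z_def)
qed

lemma scal_Z: "scal Z = scal (M\<^sub>1 \<box> M\<^sub>2)" and ground_Z: "ground Z = ground M\<^sub>1 \<times> ground M\<^sub>2"
  by (simp_all add: Z_def)

lemma subspaces_P: "subspaces (M\<^sub>1 \<box> M\<^sub>2) = Z.Sub"
  by (simp add: subspaces_def scal_Z ground_Z ground_P)

lemma Times_Sub: "A \<in> M1.Sub \<Longrightarrow> B \<in> M2.Sub \<Longrightarrow> A \<times> B \<in> Z.Sub"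
  using Times_subspace[of A B] by (auto simp: Z.Sub_iff M1.Sub_iff M2.Sub_iff scal_Z ground_Z)

text \<open>For \<open>V\<close> inside the ground space this is
  \<open>\<pi>\<^sub>1(V \<inter> \<iota>\<^sub>1(E\<^sub>1))\<close> from
  \<open>free_indep\<close>, that is, the kernel of \<open>snd\<close> on \<open>V\<close> regarded
  as a subspace of the first ground space.\<close>

definition slice :: "('v \<times> 'w) set \<Rightarrow> 'v set" where "slice V = {x. (x, 0) \<in> V}"

lemma lin_fst: "lin_on (scal Z) (scal M\<^sub>1) V fst" and lin_snd: "lin_on (scal Z) (scal M\<^sub>2) V snd"
  by (simp_all add: lin_on_def scal_Z scal_P)

lemma slice_eq_fst: "slice V = fst ` {z \<in> V. snd z = 0}"
  by (force simp: slice_def)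

lemma kernel_snd_Sub: "V \<in> Z.Sub \<Longrightarrow> {z \<in> V. snd z = 0} \<in> Z.Sub"
  using subspace_preimage[OF Z.vector_space_axioms M2.vector_space_axioms _ lin_snd, of V "{0}"]
  by (auto simp: Z.Sub_iff)

lemma slice_Sub: "V \<in> Z.Sub \<Longrightarrow> slice V \<in> M1.Sub"
  unfolding slice_eq_fst
  using subspace_image[OF Z.vector_space_axioms M1.vector_space_axioms _ lin_fst] kernel_snd_Sub[of V]
  by (auto simp: M1.Sub_iff Z.Sub_iff ground_Z)

lemma snd_Sub: "V \<in> Z.Sub \<Longrightarrow> snd ` V \<in> M2.Sub"
  using subspace_image[OF Z.vector_space_axioms M2.vector_space_axioms _ lin_snd, of V]
  by (auto simp: M2.Sub_iff Z.Sub_iff ground_Z)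

lemma dim_slice_snd:
  assumes V: "V \<in> Z.Sub"
  shows "Z.dim V = M1.dim (slice V) + M2.dim (snd ` V)"
proof -
  let ?K = "{z \<in> V. snd z = 0}"
  have "Z.dim V = Z.dim ?K + M2.dim (snd ` V)"
    by (rule dim_kernel_image[OF Z.vector_space_axioms M2.vector_space_axioms _ Z.finite_Sub[OF V] lin_snd])
      (use V in \<open>simp add: Z.Sub_iff\<close>)
  moreover have "Z.dim ?K = Z.dim {z \<in> ?K. fst z = 0} + M1.dim (fst ` ?K)"
    by (rule dim_kernel_image[OF Z.vector_space_axioms M1.vector_space_axioms _
          Z.finite_Sub[OF kernel_snd_Sub[OF V]] lin_fst])
      (use kernel_snd_Sub[OF V] in \<open>simp add: Z.Sub_iff\<close>)
  moreover have "{z \<in> ?K. fst z = 0} = {0}"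
    using Z.zero_mem[OF V] by (auto simp: zero_prod_def)
  ultimately show ?thesis by (simp add: slice_eq_fst)
qed

lemma free_indep_iff:
  "free_indep M\<^sub>1 M\<^sub>2 I \<longleftrightarrow>
    I \<in> Z.Sub \<and> indep M\<^sub>1 (slice I) \<and> nullity M\<^sub>2 (snd ` I) \<le> corank M\<^sub>1 (slice I)"
proof -
  have "fst ` (I \<inter> (\<lambda>x. (x, 0)) ` ground M\<^sub>1) = slice I" if "I \<subseteq> ground M\<^sub>1 \<times> ground M\<^sub>2"
    using that by (force simp: slice_def)
  then show ?thesis
    by (auto simp: free_indep_def Z.Sub_iff scal_Z ground_Z free_product_def)
qed

text \<open>By \<open>dim_slice_snd\<close> and independence of the slice, the condition nullity at
  most corank reads dim I <= r1(E1) + r2(snd I). This gives the second bound; the first comes from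
  the slice alone.\<close>

lemma free_indep_dim_le:
  assumes I: "free_indep M\<^sub>1 M\<^sub>2 I" and V: "V \<in> Z.Sub" and IV: "I \<subseteq> V"
  shows "int (Z.dim I) \<le> min (M1.r (slice V) + int (M2.dim (snd ` V))) (M1.r M1.E + M2.r (snd ` V))"
proof -
  have IS: "I \<in> Z.Sub" and ind: "M1.r (slice I) = int (M1.dim (slice I))"
    and c: "nullity M\<^sub>2 (snd ` I) \<le> corank M\<^sub>1 (slice I)"
    using I by (auto simp: free_indep_iff indep_def)
  have "M1.r (slice I) \<le> M1.r (slice V)"
    using IV by (intro M1.rank_mono slice_Sub IS V) (auto simp: slice_def)
  moreover have "M2.dim (snd ` I) \<le> M2.dim (snd ` V)" "M2.r (snd ` I) \<le> M2.r (snd ` V)"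
    using IV by (auto intro!: M2.dim_mono M2.rank_mono snd_Sub IS V)
  ultimately show ?thesis
    using c ind dim_slice_snd[OF IS] by (auto simp: nullity_def corank_def)
qed

text \<open>The space is assembled from a maximal independent slice \<open>J\<close> and a
  projection \<open>U\<close> that is as large as the corank of \<open>J\<close> permits.\<close>

lemma exists_free_indep:
  assumes V: "V \<in> Z.Sub"
  obtains I where "free_indep M\<^sub>1 M\<^sub>2 I" "I \<subseteq> V"
    "int (Z.dim I) = min (M1.r (slice V) + int (M2.dim (snd ` V))) (M1.r M1.E + M2.r (snd ` V))"
proof -
  note sV = slice_Sub[OF V] and nV = snd_Sub[OF V]
  obtain J where J: "indep M\<^sub>1 J" "J \<subseteq> slice V" "int (M1.dim J) = M1.r (slice V)"
    using M1.exists_indep[OF sV] by blast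
  obtain U\<^sub>0 where U0: "indep M\<^sub>2 U\<^sub>0" "U\<^sub>0 \<subseteq> snd ` V" "int (M2.dim U\<^sub>0) = M2.r (snd ` V)"
    using M2.exists_indep[OF nV] by blast
  have JS: "J \<in> M1.Sub" and rJ: "M1.r J = M1.dim J" and U0S: "U\<^sub>0 \<in> M2.Sub" and rU0: "M2.r U\<^sub>0 = M2.dim U\<^sub>0"
    using J U0 by (auto simp: indep_def)
  \<comment> \<open>\<open>U\<close> will have the rank of \<open>snd\<close>
    V\<open>, hence nullity\<close>d\<open>minus that rank. This may not exceed the corank of\<close>J\<open>, and\<close>U\<open>must fit into\<close>snd
    \<open>V\<close>; \<open>d\<close> is the largest such value.\<close>
  define d where "d = min (M2.dim (snd ` V)) (nat (M1.r M1.E - M1.r (slice V) + M2.r (snd ` V)))"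
  have "M1.r (slice V) \<le> M1.r M1.E"
    using sV by (intro M1.rank_mono M1.E_Sub) (simp_all add: M1.Sub_iff)
  then have d: "M2.dim U\<^sub>0 \<le> d" "d \<le> M2.dim (snd ` V)"
      "int d = min (int (M2.dim (snd ` V))) (M1.r M1.E - M1.r (slice V) + M2.r (snd ` V))"
    using U0(3) M2.dim_mono[OF U0S nV U0(2)] by (auto simp: d_def)
  obtain U where U: "U \<in> M2.Sub" "U\<^sub>0 \<subseteq> U" "U \<subseteq> snd ` V" "M2.dim U = d"
    using M2.exists_intermediate_dim[OF U0S nV U0(2) d(1,2)] by blast
  have rU: "M2.r U = M2.r (snd ` V)"
    using M2.rank_mono[OF U0S U(1,2)] M2.rank_mono[OF U(1) nV U(3)] U0(3) rU0 by simp
  let ?W = "{z \<in> V. snd z \<in> U}" and ?K = "{z \<in> V. snd z = 0}"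
  have W: "?W \<in> Z.Sub"
    using subspace_preimage[OF Z.vector_space_axioms M2.vector_space_axioms _ lin_snd, of V U] V U(1)
    by (auto simp: Z.Sub_iff M2.Sub_iff)
  note K = kernel_snd_Sub[OF V]
  have "?K \<subseteq> ?W" using M2.zero_mem[OF U(1)] by auto
  \<comment> \<open>\<open>C\<close> is a section of \<open>snd\<close> over \<open>U\<close>
    meeting the kernel trivially. Adding \<open>J \<times> {0}\<close> then makes the slice exactly
    \<open>J\<close> without changing the projection.\<close>
  then obtain C where C: "C \<in> Z.Sub" "C \<subseteq> ?W" "?K \<oplus> C = ?W" "?K \<inter> C = {0}"
    using Z.exists_complement[OF K W] by blast
  let ?J = "J \<times> {0}"
  have J': "?J \<in> Z.Sub" by (rule Times_Sub[OF JS M2.zero_Sub])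
  let ?I = "?J \<oplus> C"
  have I: "?I \<in> Z.Sub" using J' C(1) by blast
  have "slice ?I = J"
  proof
    show "J \<subseteq> slice ?I"
      using Z.ssum_upper1[OF J' C(1)] by (auto simp: slice_def)
    show "slice ?I \<subseteq> J"
    proof
      fix x assume "x \<in> slice ?I"
      then obtain j c where jc: "(x, 0) = (j, 0) + c" "j \<in> J" "c \<in> C"
        by (auto simp: slice_def ssum_def)
      then have "snd c = 0" by (cases c) simp
      then have "c \<in> ?K \<inter> C" using jc C(2) by blast
      then show "x \<in> J" using jc C(4) by simp
    qed
  qed
  moreover have "snd ` ?I = U"
  proof
    show "snd ` ?I \<subseteq> U" using C(2) by (auto simp: ssum_def)
    show "U \<subseteq> snd ` ?I"
    proof
      fix u assume u: "u \<in> U"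
      then obtain v where v: "v \<in> V" "snd v = u" using U(3) by blast
      then have "v \<in> ?K \<oplus> C" unfolding C(3) using u by blast
      then obtain k c where "v = k + c" "snd k = 0" "c \<in> C" by (auto simp: ssum_def)
      then have "u = snd c" "c \<in> ?I" using v Z.ssum_upper2[OF J' C(1)] by auto
      then show "u \<in> snd ` ?I" by blast
    qed
  qed
  moreover have "?I \<subseteq> V"
    by (rule Z.ssum_least[OF V]) (use J(2) C(2) in \<open>auto simp: slice_def\<close>)
  ultimately show thesis
    using that[of ?I] J(1,3) I rJ dim_slice_snd[OF I] U(4) rU d(3)
    by (simp add: free_indep_iff nullity_def corank_def min_add_distrib_right)
qed

lemma rank_P:
  assumes V: "V \<in> Z.Sub"
  shows "rank (M\<^sub>1 \<box> M\<^sub>2) V =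
    min (M1.r (slice V) + int (M2.dim (snd ` V))) (M1.r M1.E + M2.r (snd ` V))"
proof -
  let ?D = "{Z.dim I |I. free_indep M\<^sub>1 M\<^sub>2 I \<and> I \<subseteq> V}"
  obtain I where I: "free_indep M\<^sub>1 M\<^sub>2 I" "I \<subseteq> V"
    "int (Z.dim I) = min (M1.r (slice V) + int (M2.dim (snd ` V))) (M1.r M1.E + M2.r (snd ` V))"
    using exists_free_indep[OF V] by blast
  have "?D \<subseteq> {..Z.dim I}" using free_indep_dim_le[OF _ V] I(3) by force
  moreover have "Z.dim I \<in> ?D" using I by blast
  ultimately have "Max ?D = Z.dim I" by (intro Max_eqI) (auto intro: finite_subset)
  moreover have "rank (M\<^sub>1 \<box> M\<^sub>2) V = int (Max ?D)"
    by (simp add: free_product_def scal_Z)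
  ultimately show ?thesis using I(3) by simp
qed

lemma qmatroid_P: "qmatroid (M\<^sub>1 \<box> M\<^sub>2)"
proof -
  let ?P = "M\<^sub>1 \<box> M\<^sub>2"
  have bounds: "0 \<le> rank ?P V" "rank ?P V \<le> int (Z.dim V)" if V: "V \<in> Z.Sub" for V
    using M1.rank_bounds[OF slice_Sub[OF V]] M2.rank_bounds[OF snd_Sub[OF V]]
      M1.rank_bounds[OF M1.E_Sub] dim_slice_snd[OF V] by (simp_all add: rank_P[OF V] min_le_iff_disj)
  have mono: "rank ?P V \<le> rank ?P W" if VW: "V \<in> Z.Sub" "W \<in> Z.Sub" "V \<subseteq> W" for V W
  proof -
    have "M1.r (slice V) \<le> M1.r (slice W)"
      using VW by (intro M1.rank_mono slice_Sub) (auto simp: slice_def)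
    moreover have "M2.dim (snd ` V) \<le> M2.dim (snd ` W)" "M2.r (snd ` V) \<le> M2.r (snd ` W)"
      using VW by (auto intro!: M2.dim_mono M2.rank_mono snd_Sub)
    ultimately show ?thesis by (simp add: rank_P VW min_le_iff_disj)
  qed
  \<comment> \<open>Split by the bound of \<open>rank_P\<close> attained at \<open>V\<close> and at
    \<open>W\<close>. If it is the same bound, it is also used for the sum and the intersection. In
    the mixed cases the second bound is taken for the sum, the first for the intersection, and the
    growth of the second rank is estimated by \<open>rank_increase\<close>.\<close>
  have submod: "rank ?P (V \<oplus> W) + rank ?P (V \<inter> W) \<le> rank ?P V + rank ?P W"
    if V: "V \<in> Z.Sub" and W: "W \<in> Z.Sub" for V W
  proof -
    have S: "V \<oplus> W \<in> Z.Sub" and I: "V \<inter> W \<in> Z.Sub" using V W by blast+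
    note sV = slice_Sub[OF V] and sW = slice_Sub[OF W] and sS = slice_Sub[OF S] and sI = slice_Sub[OF I]
      and nV = snd_Sub[OF V] and nW = snd_Sub[OF W] and nI = snd_Sub[OF I]
    have slice_I: "slice (V \<inter> W) = slice V \<inter> slice W" by (auto simp: slice_def)
    have snd_S: "snd ` (V \<oplus> W) = snd ` V \<oplus> snd ` W" by (force simp: ssum_def)
    have nS: "snd ` V \<oplus> snd ` W \<in> M2.Sub" and nVW: "snd ` V \<inter> snd ` W \<in> M2.Sub"
      and sVW: "slice V \<oplus> slice W \<in> M1.Sub" using nV nW sV sW by blast+
    have snd_I: "snd ` (V \<inter> W) \<subseteq> snd ` V \<inter> snd ` W" by blast
    \<comment> \<open>This inclusion and \<open>snd_I\<close> can both be strict. By the dimension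
      formulas the two gaps have the same size, so they compensate each other when the first bound
      is used throughout.\<close>
    have "slice V \<oplus> slice W \<subseteq> slice (V \<oplus> W)" by (force simp: ssum_def slice_def)
    note dims = dim_slice_snd[OF V] dim_slice_snd[OF W] dim_slice_snd[OF S] dim_slice_snd[OF I]
      Z.dim_ssum_Int[OF V W] M1.dim_ssum_Int[OF sV sW] M2.dim_ssum_Int[OF nV nW]
      M2.dim_mono[OF nI nVW snd_I]
      and ranks = M1.rank_increase[OF sVW sS \<open>slice V \<oplus> slice W \<subseteq> slice (V \<oplus> W)\<close>]
        M1.rank_submod[OF sV sW] M2.rank_submod[OF nV nW] M2.rank_mono[OF nI nVW snd_I]
        M2.rank_increase[OF nV nS M2.ssum_upper1[OF nV nW]]
        M2.rank_increase[OF nW nS M2.ssum_upper2[OF nV nW]]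
        M1.rank_mono[OF sI sV] M1.rank_mono[OF sI sW]
    have "M1.r (slice (V \<inter> W)) \<le> M1.r (slice V)" "M1.r (slice (V \<inter> W)) \<le> M1.r (slice W)"
      using ranks(7,8) by (auto simp: slice_I)
    then show ?thesis
      using dims ranks(1-6) unfolding rank_P[OF V] rank_P[OF W] rank_P[OF S] rank_P[OF I] snd_S slice_I
      by linarith
  qed
  have "\<exists>B. finite B \<and> ground ?P = module.span (scal ?P) B"
    using Z.qmatroid by (simp add: qmatroid_def scal_Z ground_Z ground_P)
  then show ?thesis
    unfolding qmatroid_def subspaces_P
    using vector_space_P bounds mono submod by (simp add: scal_Z ssum_def)
qed

sublocale P: qmat "M\<^sub>1 \<box> M\<^sub>2"
  by unfold_locales (rule qmatroid_P)

section \<open>The separator of a free product and its two minors\<close>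

definition K :: "('v \<times> 'w) set" where "K = ground M\<^sub>1 \<times> {0}"

lemma K_Sub: "K \<in> Z.Sub"
  unfolding K_def by (rule Times_Sub[OF M1.E_Sub M2.zero_Sub])

lemma rank_zero_snd: "V \<in> Z.Sub \<Longrightarrow> V \<subseteq> K \<Longrightarrow> rank (M\<^sub>1 \<box> M\<^sub>2) V = M1.r (slice V)"
proof -
  assume V: "V \<in> Z.Sub" and VK: "V \<subseteq> K"
  have "snd ` V = {0}" using VK Z.zero_mem[OF V] by (force simp: K_def)
  moreover have "M1.r (slice V) \<le> M1.r M1.E"
    using slice_Sub[OF V] by (intro M1.rank_mono M1.E_Sub) (simp_all add: M1.Sub_iff)
  ultimately show ?thesis by (simp add: rank_P[OF V])
qed

lemma rank_above_K: "V \<in> Z.Sub \<Longrightarrow> K \<subseteq> V \<Longrightarrow> rank (M\<^sub>1 \<box> M\<^sub>2) V = M1.r M1.E + M2.r (snd ` V)"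
proof -
  assume V: "V \<in> Z.Sub" and KV: "K \<subseteq> V"
  have "slice V = M1.E" using KV slice_Sub[OF V] by (auto simp: K_def slice_def M1.Sub_iff)
  then show ?thesis using M2.rank_bounds(2)[OF snd_Sub[OF V]] by (simp add: rank_P[OF V])
qed

text \<open>The first bound of \<open>rank_P\<close> is attained when \<open>K\<close> contains all
  the nullity of \<open>V\<close>, the second when \<open>V\<close> spans \<open>K\<close>; a
  minimum attains one of them.\<close>

lemma sep_K: "free_separator (M\<^sub>1 \<box> M\<^sub>2) K"
  unfolding free_separator_def subspaces_P
proof (intro conjI ballI K_Sub)
  fix V assume V: "V \<in> Z.Sub"
  have VK: "V \<oplus> K \<in> Z.Sub" "V \<inter> K \<in> Z.Sub" using V K_Sub by blast+
  have "snd ` (V \<oplus> K) = snd ` V"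
    using M1.zero_mem[OF M1.E_Sub] by (force simp: ssum_def K_def)
  then have r: "rank (M\<^sub>1 \<box> M\<^sub>2) (V \<oplus> K) = M1.r M1.E + M2.r (snd ` V)"
    using rank_above_K[OF VK(1) Z.ssum_upper2[OF V K_Sub]] by simp
  have s: "slice (V \<inter> K) = slice V"
    using slice_Sub[OF V] by (auto simp: slice_def K_def M1.Sub_iff)
  have "snd ` (V \<inter> K) \<subseteq> {0}" by (auto simp: K_def)
  then have "snd ` (V \<inter> K) = {0}" using M2.zero_mem[OF snd_Sub[OF VK(2)]] by blast
  then have "nullity (M\<^sub>1 \<box> M\<^sub>2) (V \<inter> K) = int (M1.dim (slice V)) - M1.r (slice V)"
    using rank_zero_snd[OF VK(2)] dim_slice_snd[OF VK(2)] s
    by (simp add: nullity_def scal_Z)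
  then show "rank (M\<^sub>1 \<box> M\<^sub>2) (V \<oplus> K) = rank (M\<^sub>1 \<box> M\<^sub>2) V \<or>
      nullity (M\<^sub>1 \<box> M\<^sub>2) (V \<inter> K) = nullity (M\<^sub>1 \<box> M\<^sub>2) V"
    using r rank_P[OF V] dim_slice_snd[OF V] by (auto simp: nullity_def scal_Z min_def)
qed

lemma minor_map_fst: "minor_map (M\<^sub>1 \<box> M\<^sub>2) {0} K M\<^sub>1 fst"
  unfolding minor_map_def
proof (intro conjI ballI impI)
  show "lin_on (scal (M\<^sub>1 \<box> M\<^sub>2)) (scal M\<^sub>1) K fst" using lin_fst by (simp add: scal_Z)
  show "fst ` K = ground M\<^sub>1" "{x \<in> K. fst x = 0} = {0}"
    using M1.zero_mem[OF M1.E_Sub] by (force simp: K_def zero_prod_def)+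
  fix V assume V: "V \<in> subspaces (M\<^sub>1 \<box> M\<^sub>2)" "V \<subseteq> K"
  have "fst ` V = slice V" using V(2) by (force simp: K_def slice_def)
  then show "rank M\<^sub>1 (fst ` V) = rank (M\<^sub>1 \<box> M\<^sub>2) V - rank (M\<^sub>1 \<box> M\<^sub>2) {0}"
    using rank_zero_snd V P.rank_zero by (simp add: subspaces_P)
qed

lemma minor_map_snd: "minor_map (M\<^sub>1 \<box> M\<^sub>2) K (ground (M\<^sub>1 \<box> M\<^sub>2)) M\<^sub>2 snd"
  unfolding minor_map_def
proof (intro conjI ballI impI)
  show "lin_on (scal (M\<^sub>1 \<box> M\<^sub>2)) (scal M\<^sub>2) (ground (M\<^sub>1 \<box> M\<^sub>2)) snd"
    using lin_snd by (simp add: scal_Z)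
  show "snd ` ground (M\<^sub>1 \<box> M\<^sub>2) = ground M\<^sub>2"
    "{x \<in> ground (M\<^sub>1 \<box> M\<^sub>2). snd x = 0} = K"
    using M1.zero_mem[OF M1.E_Sub] M2.zero_mem[OF M2.E_Sub] by (force simp: K_def ground_P)+
  fix V assume V: "V \<in> subspaces (M\<^sub>1 \<box> M\<^sub>2)" "K \<subseteq> V"
  have "snd ` K = {0}" using M1.zero_mem[OF M1.E_Sub] by (force simp: K_def)
  then show "rank M\<^sub>2 (snd ` V) = rank (M\<^sub>1 \<box> M\<^sub>2) V - rank (M\<^sub>1 \<box> M\<^sub>2) K"
    using rank_above_K V K_Sub M2.rank_zero by (simp add: subspaces_P)
qed

end

subsection \<open>Irreducible factors\<close>

context qmat_minor
begin

lemma pre_zero: "pre {0} = K"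
  using kernel by (simp add: pre_def)

lemma pre_ground: "pre (ground P) = L"
  using image_L by (auto simp: pre_def)

text \<open>A separator strictly between \<open>K\<close> and \<open>L\<close> would have a proper
  nonzero image, which is a separator of \<open>P\<close> by \<open>sep_image\<close>.\<close>

lemma cover_of_irreducible_sep:
  assumes KL: "free_separator N K" "free_separator N L" and ne: "ground P \<noteq> {0}"
    and sep: "\<And>T. free_separator P T \<Longrightarrow> T = {0} \<or> T = ground P"
  shows "N.cover K L"
  unfolding N.cover_def
proof (intro conjI allI impI KL)
  have "K \<noteq> L"
  proof
    assume "K = L"
    then have "\<tau> ` L \<subseteq> {0}" using kernel by blast
    then show False using image_L ne P.zero_mem[OF P.E_Sub] by blast
  qed
  then show "K \<subset> L" using K_le_L by blast
  fix S assume S: "free_separator N S" "K \<subseteq> S" "S \<subseteq> L"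
  have "S = pre (\<tau> ` S)" using pre_image[OF N.sep_Sub[OF S(1)] S(2,3)] by simp
  then show "S = K \<or> S = L" using sep[OF sep_image[OF S]] pre_zero pre_ground by auto
qed

lemma cover_pre:
  assumes KL: "free_separator N K" "free_separator N L" and AB: "P.cover A B"
  shows "N.cover (pre A) (pre B)"
  unfolding N.cover_def
proof (intro conjI allI impI)
  have A: "free_separator P A" and B: "free_separator P B" and sub: "A \<subset> B"
    using AB by (auto simp: P.cover_def)
  have AE: "A \<subseteq> ground P" and BE: "B \<subseteq> ground P"
    using P.sep_Sub[OF A] P.sep_Sub[OF B] by (simp_all add: P.Sub_iff)
  show "free_separator N (pre A)" "free_separator N (pre B)" using sep_pre[OF KL] A B by auto
  have "pre A \<noteq> pre B" using image_pre[OF AE] image_pre[OF BE] sub by (metis less_irrefl)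
  moreover have "pre A \<subseteq> pre B" using sub by (auto simp: pre_def)
  ultimately show "pre A \<subset> pre B" by blast
  fix S assume S: "free_separator N S" "pre A \<subseteq> S" "S \<subseteq> pre B"
  have KS: "K \<subseteq> S" "S \<subseteq> L" using S K_le_pre[OF P.sep_Sub[OF A]] pre_le_L[of B] by blast+
  have "A \<subseteq> \<tau> ` S" using image_mono[OF S(2), of \<tau>] image_pre[OF AE] by simp
  moreover have "\<tau> ` S \<subseteq> B" using image_mono[OF S(3), of \<tau>] image_pre[OF BE] by simp
  ultimately have "\<tau> ` S = A \<or> \<tau> ` S = B"
    using AB sep_image[OF S(1) KS] unfolding P.cover_def by blast
  then show "S = pre A \<or> S = pre B" using pre_image[OF N.sep_Sub[OF S(1)] KS] by auto
qed

text \<open>A flag ends at the ground space, and the pulled back one ends at \<open>L\<close>; so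
  \<open>L\<close> has to be the ground space of \<open>N\<close>.\<close>

lemma flag_pre:
  assumes "free_separator N K" "L = ground N"
  shows "P.flag A Bs \<Longrightarrow> N.flag (pre A) (map pre Bs)"
proof (induction Bs arbitrary: A)
  case Nil
  then show ?case using pre_ground assms(2) by simp
next
  case (Cons B Bs)
  then show ?case using cover_pre assms N.sep_E by simp
qed

lemma flag_factors_pre:
  "P.flag A Bs \<Longrightarrow> P.flag_factors A Bs Xs \<Longrightarrow> N.flag_factors (pre A) (map pre Bs) Xs"
proof (induction Bs arbitrary: A Xs)
  case Nil
  then show ?case by (cases Xs) auto
next
  case (Cons B Bs)
  obtain X Xs' where Xs: "Xs = X # Xs'" using Cons.prems by (cases Xs) auto
  have AB: "A \<in> subspaces P" "B \<in> subspaces P" "A \<subseteq> B"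
    using Cons.prems(1) P.sep_Sub by (auto simp: P.cover_def)
  obtain \<sigma> where "minor_map P A B X \<sigma>" using Cons.prems(2) by (auto simp: Xs minor_def)
  then have "minor N (pre A) (pre B) X" using minor_map_comp[OF AB] by (auto simp: minor_def)
  then show ?case using Cons by (simp add: Xs)
qed

end

context qmat
begin

text \<open>A proper nonzero separator \<open>T\<close> would make \<open>M\<close> isomorphic to
  the free product of M|T and M/T. The contraction is realized on a complement \<open>C\<close> of
  \<open>T\<close>, because the factors in \<open>irreducible_qmat\<close> live on the type of
  \<open>M\<close>.\<close>

lemma sep_irreducible:
  assumes irr: "irreducible_qmat M" and T: "sep T"
  shows "T = {0} \<or> T = E"
proof (rule ccontr)
  assume nontriv: "\<not> ?thesis"
  note TS = sep_Sub[OF T]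
  have TE: "T \<subseteq> E" using TS by (simp add: Sub_iff)
  obtain C where C: "C \<in> Sub" "C \<subseteq> E" "T \<oplus> C = E" "T \<inter> C = {0}"
    using exists_complement[OF TS E_Sub TE] by blast
  define M\<^sub>1 where "M\<^sub>1 = \<lparr>scal = scal M, ground = T, rank = r\<rparr>"
  define M\<^sub>2 where "M\<^sub>2 = \<lparr>scal = scal M, ground = C, rank = (\<lambda>V. r (V \<oplus> T) - r T)\<rparr>"
  have sub1: "V \<in> subspaces M\<^sub>1 \<longleftrightarrow> V \<in> Sub \<and> V \<subseteq> T" for V
    using TE by (auto simp: subspaces_def M\<^sub>1_def)
  have sub2: "V \<in> subspaces M\<^sub>2 \<longleftrightarrow> V \<in> Sub \<and> V \<subseteq> C" for V
    using C(2) by (auto simp: subspaces_def M\<^sub>2_def)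
  have fin: "\<exists>B. finite B \<and> V = span B" if "V \<in> Sub" for V
    using that finite_Sub span_eq_iff by (metis Sub_iff)
  have "qmatroid M\<^sub>1"
    unfolding qmatroid_def sub1 Ball_def
    using vector_space_axioms fin[OF TS] rank_bounds rank_mono rank_submod
    by (auto simp: M\<^sub>1_def ssum_def)
  moreover have "qmatroid M\<^sub>2"
    unfolding qmatroid_def
  proof (intro conjI ballI impI)
    show "vector_space (scal M\<^sub>2)" using vector_space_axioms by (simp add: M\<^sub>2_def)
    show "\<exists>B. finite B \<and> ground M\<^sub>2 = module.span (scal M\<^sub>2) B"
      using fin[OF C(1)] by (simp add: M\<^sub>2_def)
    fix A assume A: "A \<in> subspaces M\<^sub>2"
    then have AS: "A \<in> Sub" by (simp add: sub2)
    have AT: "A \<oplus> T \<in> Sub" using AS TS by blast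
    show "0 \<le> rank M\<^sub>2 A"
      using rank_mono[OF TS AT ssum_upper2[OF AS TS]] by (simp add: M\<^sub>2_def)
    show "rank M\<^sub>2 A \<le> int (vector_space.dim (scal M\<^sub>2) A)"
      using rank_increase[OF TS AT ssum_upper2[OF AS TS]] dim_ssum_Int[OF AS TS]
      by (simp add: M\<^sub>2_def)
    fix B assume B: "B \<in> subspaces M\<^sub>2"
    then have BS: "B \<in> Sub" by (simp add: sub2)
    have BT: "B \<oplus> T \<in> Sub" using BS TS by blast
    show "rank M\<^sub>2 A \<le> rank M\<^sub>2 B" if "A \<subseteq> B"
      using rank_mono[OF AT BT ssum_mono[OF that order_refl]] by (simp add: M\<^sub>2_def)
    have "(A \<oplus> T) \<oplus> (B \<oplus> T) = (A \<oplus> B) \<oplus> T"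
    proof -
      have "T \<oplus> (B \<oplus> T) = B \<oplus> T" by (rule ssum_absorb2[OF BT TS ssum_upper2[OF BS TS]])
      then show ?thesis by (simp add: ssum_assoc)
    qed
    moreover have "r ((A \<inter> B) \<oplus> T) \<le> r ((A \<oplus> T) \<inter> (B \<oplus> T))"
      using AS BS TS AT BT by (intro rank_mono ssum_Sub Int_Sub Int_greatest ssum_mono) auto
    ultimately have "r (A \<oplus> B \<oplus> T) + r ((A \<inter> B) \<oplus> T) \<le> r (A \<oplus> T) + r (B \<oplus> T)"
      using rank_submod[OF AT BT] by simp
    then show "rank M\<^sub>2 {a + b |a b. a \<in> A \<and> b \<in> B} + rank M\<^sub>2 (A \<inter> B) \<le> rank M\<^sub>2 A + rank M\<^sub>2 B"
      by (simp add: M\<^sub>2_def flip: ssum_def)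
  qed
  ultimately interpret F: free_prod M\<^sub>1 M\<^sub>2
    by unfold_locales
  \<comment> \<open>Addition identifies the external sum of \<open>T\<close> and \<open>C\<close>
    with the internal one.\<close>
  let ?P = "M\<^sub>1 \<box> M\<^sub>2" and ?f = "\<lambda>z. fst z + snd z"
  have gP: "ground ?P = T \<times> C" unfolding F.ground_P by (simp add: M\<^sub>1_def M\<^sub>2_def)
  have sP: "scal ?P c z = (scal M c (fst z), scal M c (snd z))" for c z
    unfolding F.scal_P by (simp add: M\<^sub>1_def M\<^sub>2_def)
  have lin: "lin_on (scal ?P) (scal M) V ?f" for V
    by (auto simp: lin_on_def sP scale_right_distrib algebra_simps)
  have ker: "{z \<in> T \<times> C. ?f z = 0} = {0}"
  proof
    show "{z \<in> T \<times> C. ?f z = 0} \<subseteq> {0}"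
    proof
      fix z assume "z \<in> {z \<in> T \<times> C. ?f z = 0}"
      then obtain t c where z: "z = (t, c)" "t \<in> T" "c \<in> C" "t = - c"
        by (auto simp: add_eq_0_iff2)
      then have "t \<in> C" using C(1) subspace_neg[of C c] by (simp add: Sub_iff)
      then have "t = 0" using z(2) C(4) by blast
      then show "z \<in> {0}" using z by (simp add: zero_prod_def)
    qed
    show "{0} \<subseteq> {z \<in> T \<times> C. ?f z = 0}"
      using zero_mem[OF TS] zero_mem[OF C(1)] by (simp add: zero_prod_def)
  qed
  have "minor_map ?P {0} (ground ?P) M ?f"
    unfolding minor_map_def gP
  proof (intro conjI ballI impI lin ker)
    show "?f ` (T \<times> C) = E" unfolding C(3)[symmetric] by (force simp: ssum_def)
    fix V assume V: "V \<in> subspaces ?P" "V \<subseteq> T \<times> C"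
    note VZ = V(1)[unfolded F.subspaces_P]
    let ?W = "?f ` V"
    have sV: "F.Z.subspace V" "module.subspace (scal ?P) V"
      using VZ by (simp_all add: F.Z.Sub_iff F.scal_Z)
    have "?W \<subseteq> T \<oplus> C" using V(2) by (force simp: ssum_def)
    then have W: "?W \<in> Sub"
      using subspace_image[OF F.vector_space_P vector_space_axioms sV(2) lin] C(3)
      by (simp add: Sub_iff)
    have "{z \<in> V. ?f z = 0} = {0}"
      using ker V(2) F.Z.zero_mem[OF VZ] by blast
    then have dW: "dim ?W = F.Z.dim V"
      using dim_kernel_image[OF F.vector_space_P vector_space_axioms sV(2) F.Z.finite_Sub[OF VZ] lin]
        F.Z.dim_zero by (simp add: F.scal_Z)
    have WT: "?W \<oplus> T = snd ` V \<oplus> T"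
    proof
      show "?W \<oplus> T \<subseteq> snd ` V \<oplus> T"
      proof
        fix x assume "x \<in> ?W \<oplus> T"
        then obtain v t where v: "x = (fst v + snd v) + t" "v \<in> V" "t \<in> T" by (auto simp: ssum_def)
        then have "fst v + t \<in> T" using V(2) TS subspace_add[of T "fst v" t] by (auto simp: Sub_iff)
        moreover have "x = snd v + (fst v + t)" using v(1) by (simp add: algebra_simps)
        ultimately show "x \<in> snd ` V \<oplus> T" using v(2) unfolding ssum_def by blast
      qed
      show "snd ` V \<oplus> T \<subseteq> ?W \<oplus> T"
      proof
        fix x assume "x \<in> snd ` V \<oplus> T"
        then obtain v t where v: "x = snd v + t" "v \<in> V" "t \<in> T" by (auto simp: ssum_def)
        then have "t - fst v \<in> T" using V(2) TS subspace_diff[of T t "fst v"] by (auto simp: Sub_iff)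
        moreover have "x = (fst v + snd v) + (t - fst v)" using v(1) by (simp add: algebra_simps)
        ultimately show "x \<in> ?W \<oplus> T" using v(2) unfolding ssum_def by blast
      qed
    qed
    have W_T: "?W \<inter> T = F.slice V"
    proof
      show "?W \<inter> T \<subseteq> F.slice V"
      proof
        fix x assume x: "x \<in> ?W \<inter> T"
        then obtain t c where v: "x = t + c" "(t, c) \<in> V" by auto
        then have tc: "t \<in> T" "c \<in> C" using V(2) by auto
        have "x - t \<in> T" using x tc TS subspace_diff by (simp add: Sub_iff)
        then have "c = 0" using v(1) tc(2) C(4) by auto
        then show "x \<in> F.slice V" using v by (simp add: F.slice_def)
      qed
      show "F.slice V \<subseteq> ?W \<inter> T" using V(2) by (force simp: F.slice_def)
    qed
    have WT': "?W \<oplus> T \<in> Sub" "?W \<inter> T \<in> Sub" using W TS by blast+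
    have "r ?W \<le> r (?W \<oplus> T)" by (rule rank_mono[OF W WT'(1) ssum_upper1[OF W TS]])
    moreover have "r ?W \<le> r (?W \<inter> T) + int (dim ?W) - int (dim (?W \<inter> T))"
      using rank_increase[OF WT'(2) W] by simp
    \<comment> \<open>Both terms are upper bounds of \<open>r ?W\<close>, and the separator property
      says that one is attained. By \<open>W_T\<close> and \<open>WT\<close> they are the two bounds
      of \<open>rank_P\<close> at \<open>V\<close>.\<close>
    ultimately have "r ?W = min (r (?W \<inter> T) + int (dim ?W) - int (dim (?W \<inter> T))) (r (?W \<oplus> T))"
      using sepD[OF T W] by (auto simp: nullity_def)
    also have "\<dots> = rank ?P V"
      unfolding F.rank_P[OF VZ] W_T WT
      using F.dim_slice_snd[OF VZ] dW by (simp add: M\<^sub>1_def M\<^sub>2_def ssum_absorb[OF TS TS])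
    finally show "r ?W = rank ?P V - rank ?P {0}" using F.P.rank_zero by simp
  qed
  then have "minor ?P {0} (ground ?P) M" by (auto simp: minor_def)
  \<comment> \<open>The isomorphism from \<open>M\<close> to \<open>?P\<close> comes from
    \<open>minor_unique\<close>: both are the full minor of \<open>?P\<close>, so \<open>?f\<close>
    need not be inverted.\<close>
  moreover have "minor_map ?P {0} (ground ?P) ?P id"
    using F.P.zero_mem[OF F.P.E_Sub] F.P.rank_zero by (auto simp: minor_map_def lin_on_def)
  then have "minor ?P {0} (ground ?P) ?P" by (auto simp: minor_def)
  ultimately have "M \<cong>\<^sub>q ?P"
    by (rule F.P.minor_unique[OF qmatroid F.qmatroid_P F.P.zero_Sub F.P.E_Sub])
  moreover have "C \<noteq> {0}" using C(3) nontriv ssum_absorb[OF TS zero_Sub] zero_mem[OF TS] by auto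
  ultimately show False
    using irr nontriv F.M1.qmatroid F.M2.qmatroid
    unfolding irreducible_qmat_def M\<^sub>1_def M\<^sub>2_def by (metis qmat.select_convs(2))
qed

end

section \<open>Pulling the q-matroid structure back along isomorphisms\<close>

lemma minor_map_of_iso:
  assumes N: "qmatroid N" and P: "qmatroid P" and iso: "N \<cong>\<^sub>q P"
  obtains \<tau> where "minor_map N {0} (ground N) P \<tau>"
proof -
  interpret N: qmat N by unfold_locales fact
  interpret P: qmat P by unfold_locales fact
  obtain \<tau> where \<tau>: "bij_betw \<tau> (ground N) (ground P)" "lin_on (scal N) (scal P) (ground N) \<tau>"
      "\<And>V. V \<in> subspaces N \<Longrightarrow> rank P (\<tau> ` V) = rank N V"
    using iso by (auto simp: qmat_iso_def lin_on_def)
  note z = N.zero_mem[OF N.E_Sub] and z' = lin_on_zero[OF \<tau>(2) N.zero_mem[OF N.E_Sub]]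
  have "{x \<in> ground N. \<tau> x = 0} = {0}"
    using \<tau>(1) z z' by (auto simp: bij_betw_def inj_on_def)
  then have "minor_map N {0} (ground N) P \<tau>"
    using \<tau> N.rank_zero by (simp add: minor_map_def bij_betw_def)
  then show thesis by (rule that)
qed

text \<open>Here \<open>\<tau>\<close> is injective on the ground space and preserves dimension,
  intersection and sum, so (R1) to (R3) come back from \<open>Q\<close>. The condition
  \<open>rank N {0} = 0\<close> turns the relative ranks of \<open>minor_map\<close> into absolute
  ones.\<close>

lemma qmatroid_pullback:
  assumes N: "vector_space (scal N)" "module.subspace (scal N) (ground N)" "finite (ground N)" "rank N {0} = 0"
    and Q: "qmatroid Q" and \<tau>: "minor_map N {0} (ground N) Q \<tau>"
  shows "qmatroid N"
proof -
  interpret N: vector_space "scal N" by fact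
  interpret Q: qmat Q by unfold_locales fact
  have lin: "lin_on (scal N) (scal Q) (ground N) \<tau>" and im: "\<tau> ` ground N = ground Q"
    and ker: "{x \<in> ground N. \<tau> x = 0} = {0}"
    and rank: "\<And>V. V \<in> subspaces N \<Longrightarrow> 0 \<in> V \<Longrightarrow> V \<subseteq> ground N \<Longrightarrow> rank Q (\<tau> ` V) = rank N V"
    using \<tau> N(4) by (simp_all add: minor_map_def)
  have Sub: "V \<in> subspaces N \<longleftrightarrow> N.subspace V \<and> V \<subseteq> ground N" for V
    by (simp add: subspaces_def)
  have add: "\<tau> (x + y) = \<tau> x + \<tau> y" if "x \<in> ground N" "y \<in> ground N" for x y
    using lin that by (simp add: lin_on_def)
  have inj: "x = y" if xy: "x \<in> ground N" "y \<in> ground N" "\<tau> x = \<tau> y" for x y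
  proof -
    have d: "x - y \<in> ground N" using xy N.subspace_diff[OF N(2)] by blast
    then have "\<tau> (x - y) = 0" using add[OF d xy(2)] xy(3) by simp
    then have "x - y \<in> {0}" unfolding ker[symmetric] using d by blast
    then show ?thesis by simp
  qed
  have r: "rank Q (\<tau> ` V) = rank N V" and im_Sub: "\<tau> ` V \<in> Q.Sub" and dim: "Q.dim (\<tau> ` V) = N.dim V"
    if V: "V \<in> subspaces N" for V
  proof -
    have sV: "N.subspace V" "V \<subseteq> ground N" using V by (auto simp: Sub)
    note linV = lin_on_mono[OF lin sV(2)]
    show "rank Q (\<tau> ` V) = rank N V" using rank V sV N.subspace_0 by blast
    show "\<tau> ` V \<in> Q.Sub"
      using subspace_image[OF N(1) Q.vector_space_axioms sV(1) linV] im sV(2) by (auto simp: Q.Sub_iff)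
    have "{x \<in> V. \<tau> x = 0} = {0}" using ker sV N.subspace_0 by blast
    moreover have "N.dim {0} = 0" using N.dim_le_card[of "{0}" "{}"] by simp
    ultimately show "Q.dim (\<tau> ` V) = N.dim V"
      using dim_kernel_image[OF N(1) Q.vector_space_axioms sV(1) finite_subset[OF sV(2) N(3)] linV] by simp
  qed
  show ?thesis
    unfolding qmatroid_def
  proof (intro conjI ballI impI N(1))
    show "\<exists>B. finite B \<and> ground N = N.span B" using N(2,3) N.span_eq_iff by metis
    fix A assume A: "A \<in> subspaces N"
    show "0 \<le> rank N A" "rank N A \<le> int (N.dim A)"
      using Q.rank_bounds[OF im_Sub[OF A]] r[OF A] dim[OF A] by simp_all
    fix B assume B: "B \<in> subspaces N"
    show "rank N A \<le> rank N B" if "A \<subseteq> B"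
      using Q.rank_mono[OF im_Sub[OF A] im_Sub[OF B] image_mono[OF that]] r[OF A] r[OF B] by simp
    have sA: "N.subspace A" "A \<subseteq> ground N" and sB: "N.subspace B" "B \<subseteq> ground N"
      using A B by (auto simp: Sub)
    have "N.subspace (A \<oplus> B)" unfolding ssum_def by (rule N.subspace_sums[OF sA(1) sB(1)])
    moreover have "A \<oplus> B \<subseteq> ground N" using sA(2) sB(2) N.subspace_add[OF N(2)] by (auto simp: ssum_def)
    ultimately have AB: "A \<oplus> B \<in> subspaces N" by (simp add: Sub)
    have I: "A \<inter> B \<in> subspaces N" using sA sB N.subspace_inter by (auto simp: Sub)
    have "\<tau> ` (A \<oplus> B) = \<tau> ` A \<oplus> \<tau> ` B"
      unfolding ssum_def using sA(2) sB(2) by (force simp: add subset_iff)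
    moreover have "\<tau> ` (A \<inter> B) = \<tau> ` A \<inter> \<tau> ` B"
    proof
      show "\<tau> ` A \<inter> \<tau> ` B \<subseteq> \<tau> ` (A \<inter> B)"
      proof
        fix y assume "y \<in> \<tau> ` A \<inter> \<tau> ` B"
        then obtain a b where ab: "a \<in> A" "b \<in> B" "y = \<tau> a" "\<tau> a = \<tau> b" by auto
        then have "a = b" using inj sA(2) sB(2) by blast
        then show "y \<in> \<tau> ` (A \<inter> B)" using ab by blast
      qed
    qed blast
    ultimately have "rank N (A \<oplus> B) + rank N (A \<inter> B) \<le> rank N A + rank N B"
      using Q.rank_submod[OF im_Sub[OF A] im_Sub[OF B]] r[OF A] r[OF B] r[OF AB] r[OF I] by simp
    then show "rank N {a + b |a b. a \<in> A \<and> b \<in> B} + rank N (A \<inter> B) \<le> rank N A + rank N B"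
      by (simp add: ssum_def)
  qed
qed

section \<open>The sequence encoding of iterated products\<close>

lemma vector_space_seq_single:
  assumes "qmatroid M" shows "vector_space (scal (seq_single M))"
proof -
  interpret qmat M by unfold_locales fact
  show ?thesis
    by unfold_locales (auto simp: seq_single_def fun_eq_iff scale_right_distrib scale_left_distrib)
qed

lemma minor_map_seq_single:
  assumes M: "qmatroid M"
  shows "minor_map (seq_single M) {0} (ground (seq_single M)) M (\<lambda>f. f 0)" (is ?minor)
    and "qmatroid (seq_single M)"
proof -
  interpret qmat M by unfold_locales fact
  let ?N = "seq_single M" and ?\<phi> = "\<lambda>x. case_nat x (\<lambda>_. 0) :: nat \<Rightarrow> _"
  interpret N: vector_space "scal ?N" by (rule vector_space_seq_single[OF M])
  have gN: "ground ?N = ?\<phi> ` E" by (simp add: seq_single_def)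
  have r0: "rank ?N {0} = 0" by (simp add: seq_single_def)
  have \<phi>: "?\<phi> 0 = 0" "?\<phi> x + ?\<phi> y = ?\<phi> (x + y)" "scal ?N c (?\<phi> x) = ?\<phi> (scal M c x)" for x y c
    by (auto simp: fun_eq_iff seq_single_def split: nat.split)
  show m: ?minor
    unfolding minor_map_def
  proof (intro conjI ballI impI)
    show "lin_on (scal ?N) (scal M) (ground ?N) (\<lambda>f. f 0)"
      by (simp add: lin_on_def seq_single_def)
    show "(\<lambda>f. f 0) ` ground ?N = E" by (simp add: gN image_image)
    show "{f \<in> ground ?N. f 0 = 0} = {0}"
      using \<phi>(1) zero_mem[OF E_Sub] by (auto simp: gN intro: rev_image_eqI)
    show "rank M ((\<lambda>f. f 0) ` V) = rank ?N V - rank ?N {0}" for V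
      unfolding r0 by (simp add: seq_single_def)
  qed
  show "qmatroid ?N"
  proof (rule qmatroid_pullback[OF N.vector_space_axioms _ _ r0 M m])
    show "finite (ground ?N)" by (simp add: gN)
    show "N.subspace (ground ?N)"
      unfolding gN
    proof (rule N.subspaceI)
      show "0 \<in> ?\<phi> ` E" using \<phi>(1) zero_mem[OF E_Sub] by (metis image_eqI)
    next
      fix f g assume "f \<in> ?\<phi> ` E" "g \<in> ?\<phi> ` E"
      then show "f + g \<in> ?\<phi> ` E" using \<phi>(2) subspace_add[of E] E_Sub by (auto simp: Sub_iff)
    next
      fix c f assume "f \<in> ?\<phi> ` E"
      then show "scal ?N c f \<in> ?\<phi> ` E" using \<phi>(3) subspace_scale[of E] E_Sub by (auto simp: Sub_iff)
    qed
  qed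
qed

lemma vector_space_transport:
  fixes \<phi> :: "'b::ab_group_add \<Rightarrow> 'a::ab_group_add"
  assumes "vector_space s" and add: "\<And>x y. \<phi> (x + y) = \<phi> x + \<phi> y"
    and inv: "\<And>x. \<psi> (\<phi> x) = x" "\<And>y. \<phi> (\<psi> y) = y"
  shows "vector_space (\<lambda>c y. \<phi> (s c (\<psi> y)))"
proof -
  interpret vector_space s by fact
  have "\<psi> (x + y) = \<psi> x + \<psi> y" for x y by (metis add inv)
  then show ?thesis
    by unfold_locales (simp_all add: scale_right_distrib scale_left_distrib add inv)
qed

lemma minor_map_seq_cons:
  fixes Q :: "('k::{field,finite}, 'v::ab_group_add \<times> (nat \<Rightarrow> 'v)) qmat"
  assumes Q: "qmatroid Q"
  shows "minor_map (seq_cons Q) {0} (ground (seq_cons Q)) Q (\<lambda>f. (f 0, f \<circ> Suc))" (is ?minor)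
    and "qmatroid (seq_cons Q)"
proof -
  interpret qmat Q by unfold_locales fact
  define \<phi> :: "'v \<times> (nat \<Rightarrow> 'v) \<Rightarrow> nat \<Rightarrow> 'v" where "\<phi> = (\<lambda>(x, f). case_nat x f)"
  define \<psi> :: "(nat \<Rightarrow> 'v) \<Rightarrow> 'v \<times> (nat \<Rightarrow> 'v)" where "\<psi> = (\<lambda>f. (f 0, f \<circ> Suc))"
  have inv: "\<psi> (\<phi> z) = z" "\<phi> (\<psi> f) = f" for z f
    by (auto simp: \<phi>_def \<psi>_def fun_eq_iff split: nat.split prod.split)
  have add: "\<phi> (y + z) = \<phi> y + \<phi> z" "\<psi> (f + g) = \<psi> f + \<psi> g" for y z f g
    by (auto simp: \<phi>_def \<psi>_def fun_eq_iff split: nat.split prod.split)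
  have zero: "\<psi> 0 = 0" "\<phi> 0 = 0"
    using add(2)[of 0 0] add(1)[of 0 0] by simp_all
  let ?N = "seq_cons Q"
  have N: "scal ?N = (\<lambda>c f. \<phi> (scal Q c (\<psi> f)))" "ground ?N = \<phi> ` E" "rank ?N = (\<lambda>A. r (\<psi> ` A))"
    by (simp_all add: seq_cons_def \<phi>_def \<psi>_def Let_def)
  interpret N: vector_space "scal ?N"
    unfolding N by (rule vector_space_transport[OF vector_space_axioms add(1) inv])
  have r0: "rank ?N {0} = 0" by (simp add: N zero)
  have "minor_map ?N {0} (ground ?N) Q \<psi>"
    unfolding minor_map_def
  proof (intro conjI ballI impI)
    show "lin_on (scal ?N) (scal Q) (ground ?N) \<psi>" by (simp add: lin_on_def N inv add)
    show "\<psi> ` ground ?N = E" by (simp add: N image_image inv)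
    have "\<psi> f = 0 \<longleftrightarrow> f = 0" for f using inv zero by metis
    moreover have "0 \<in> ground ?N" using zero zero_mem[OF E_Sub] unfolding N by (metis image_eqI)
    ultimately show "{f \<in> ground ?N. \<psi> f = 0} = {0}" by auto
    show "r (\<psi> ` V) = rank ?N V - rank ?N {0}" for V
      unfolding r0 by (simp add: N)
  qed
  then show m: ?minor by (simp add: \<psi>_def)
  show "qmatroid ?N"
  proof (rule qmatroid_pullback[OF N.vector_space_axioms _ _ r0 Q m])
    show "finite (ground ?N)" by (simp add: N)
    have sE: "subspace E" using E_Sub by (simp add: Sub_iff)
    show "N.subspace (ground ?N)"
      unfolding N(2)
    proof (rule N.subspaceI)
      show "0 \<in> \<phi> ` E" using zero zero_mem[OF E_Sub] by (metis image_eqI)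
    next
      fix f g assume "f \<in> \<phi> ` E" "g \<in> \<phi> ` E"
      then show "f + g \<in> \<phi> ` E" using subspace_add[OF sE] by (auto simp flip: add)
    next
      fix c f assume "f \<in> \<phi> ` E"
      then show "scal ?N c f \<in> \<phi> ` E" using subspace_scale[OF sE] by (auto simp: N inv)
    qed
  qed
qed

section \<open>Flags of iterated products\<close>

lemma flag_factors_iso_transfer:
  assumes N: "qmatroid N" and P: "qmatroid P" and \<tau>: "minor_map N {0} (ground N) P \<tau>"
    and flag: "qmat.flag P {0} Bs" "qmat.flag_factors P {0} Bs Xs"
  shows "\<exists>Bs. qmat.flag N {0} Bs \<and> qmat.flag_factors N {0} Bs Xs"
proof -
  interpret N: qmat N by unfold_locales fact
  interpret P: qmat P by unfold_locales fact
  interpret qmat_minor N P "{0}" "ground N" \<tau> by unfold_locales (simp_all add: \<tau>)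
  show ?thesis
    using flag_pre[OF N.sep_zero refl flag(1)] flag_factors_pre[OF flag] by (auto simp: pre_zero)
qed

text \<open>The copy of the first ground space is the first step, a cover of \<open>{0}\<close> by
  irreducibility; the rest is the preimage under \<open>snd\<close> of a flag of the remaining
  product, and the result is carried through the encoding.\<close>

lemma flag_of_free_product_list:
  fixes Ms :: "('k::{field,finite}, 'v::ab_group_add) qmat list"
  assumes "Ms \<noteq> []" "\<forall>X\<in>set Ms. qmatroid X \<and> ground X \<noteq> {0} \<and> irreducible_qmat X"
  shows "qmatroid (free_product_list Ms) \<and>
    (\<exists>Bs. qmat.flag (free_product_list Ms) {0} Bs \<and> qmat.flag_factors (free_product_list Ms) {0} Bs Ms)"
  using assms
proof (induction Ms rule: free_product_list.induct)
  case (1 M)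
  then interpret M: qmat M by unfold_locales simp
  note s = minor_map_seq_single[OF M.qmatroid]
  interpret N: qmat "seq_single M" by unfold_locales (rule s(2))
  interpret qmat_minor "seq_single M" M "{0}" "ground (seq_single M)" "\<lambda>f. f 0"
    by unfold_locales (simp_all add: s)
  have "N.cover {0} (ground (seq_single M))"
    using 1 by (intro cover_of_irreducible_sep N.sep_zero N.sep_E M.sep_irreducible) simp_all
  moreover have "minor (seq_single M) {0} (ground (seq_single M)) M"
    using s(1) by (auto simp: minor_def)
  ultimately have "N.flag {0} [ground (seq_single M)]" "N.flag_factors {0} [ground (seq_single M)] [M]"
    by (simp_all only: N.flag.simps N.flag_factors.simps simp_thms)
  then show ?case using s(2) unfolding free_product_list.simps by blast
next
  case (2 M M' Ms)
  let ?T = "free_product_list (M' # Ms)"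
  obtain Bs where T: "qmatroid ?T" "qmat.flag ?T {0} Bs" "qmat.flag_factors ?T {0} Bs (M' # Ms)"
    using "2.IH" "2.prems"(2) by (metis list.set_intros(2) list.distinct(1))
  interpret F: free_prod M ?T using 2 T(1) by unfold_locales simp_all
  let ?Q = "M \<box> ?T"
  have KQ: "F.K \<in> subspaces ?Q" using F.K_Sub by (simp add: F.subspaces_P)
  interpret m1: qmat_minor ?Q M "{0}" F.K fst
    by unfold_locales (simp_all add: KQ F.minor_map_fst F.P.zero_Sub)
  interpret m2: qmat_minor ?Q ?T F.K "ground ?Q" snd
    by unfold_locales (simp_all add: KQ F.minor_map_snd F.P.E_Sub)
  have "F.P.cover {0} F.K"
    using 2 by (intro m1.cover_of_irreducible_sep F.P.sep_zero F.sep_K F.M1.sep_irreducible) simp_all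
  then have flag: "F.P.flag {0} (F.K # map m2.pre Bs)"
    using m2.flag_pre[OF F.sep_K refl T(2)] by (simp add: m2.pre_zero)
  have factors: "F.P.flag_factors {0} (F.K # map m2.pre Bs) (M # M' # Ms)"
    using m2.flag_factors_pre[OF T(2,3)] F.minor_map_fst by (auto simp: m2.pre_zero minor_def)
  note c = minor_map_seq_cons[OF F.qmatroid_P]
  show ?case
    using c(2) flag_factors_iso_transfer[OF c(2) F.qmatroid_P c(1) flag factors]
    unfolding free_product_list.simps by blast
next
  case 3
  then show ?case by simp
qed

theorem corollary4p34:
  fixes M :: "('k::{field,finite}, 'u::ab_group_add) qmat"
    and Ms :: "('k, 'v::ab_group_add) qmat list"
    and Ns :: "('k, 'w::ab_group_add) qmat list"
  assumes "qmatroid M"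
    and "Ms \<noteq> []" and "Ns \<noteq> []"
    and "\<forall>X\<in>set Ms. qmatroid X \<and> ground X \<noteq> {0} \<and> irreducible_qmat X"
    and "\<forall>X\<in>set Ns. qmatroid X \<and> ground X \<noteq> {0} \<and> irreducible_qmat X"
    and "M \<cong>\<^sub>q free_product_list Ms"
    and "free_product_list Ms \<cong>\<^sub>q free_product_list Ns"
  shows "length Ms = length Ns \<and> (\<forall>i<length Ms. Ms ! i \<cong>\<^sub>q Ns ! i)"
proof -
  let ?P = "free_product_list Ms" and ?R = "free_product_list Ns"
  obtain Bs where P: "qmatroid ?P" "qmat.flag ?P {0} Bs" "qmat.flag_factors ?P {0} Bs Ms"
    using flag_of_free_product_list[OF assms(2,4)] by blast
  obtain Cs' where R: "qmatroid ?R" "qmat.flag ?R {0} Cs'" "qmat.flag_factors ?R {0} Cs' Ns"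
    using flag_of_free_product_list[OF assms(3,5)] by blast
  interpret P: qmat ?P by unfold_locales fact
  obtain \<tau> where "minor_map ?P {0} (ground ?P) ?R \<tau>"
    using minor_map_of_iso[OF P(1) R(1) assms(7)] by blast
  \<comment> \<open>The flag of the second product is pulled back, so that both flags lie in the
    same q-matroid.\<close>
  then obtain Cs where Cs: "P.flag {0} Cs" "P.flag_factors {0} Cs Ns"
    using flag_factors_iso_transfer[OF P(1) R(1) _ R(2,3)] by blast
  \<comment> \<open>The exchange moves the labels \<open>Ns\<close> from \<open>Cs\<close> to
    \<open>Bs\<close>, where \<open>Ms\<close> labels the same steps.\<close>
  have "P.flag_factors {0} Bs Ns"
    using P.flag_factors_unique[OF _ Cs(1) P(2) Cs(2)] assms(5) by blast
  then have "list_all2 qmat_iso Ms Ns"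
    using P.flag_factors_iso[OF P(2) _ _ P(3)] assms(4,5) by blast
  then show ?thesis by (simp add: list_all2_conv_all_nth)
qed

end
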